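(* Let $M\in\mathbb{R}^{d\times d}$ be such that $M+\frac12I$ and $M-\frac12I$ are both invertible, and let $A=A_M=\begin{pmatrix}I&M+\frac12I \\ I&M-\frac12I\end{pmatrix}$. For any $1<p<\infty$ and $2\le q\le\infty$ such that $q'\le p\le q$, and any $f\in L^p(\mathbb{R}^d)$, $g\in L^{p'}(\mathbb{R}^d)$, the following hold. (i) $\mathcal{B}_A(f,g)\in L^q(\mathbb{R}^{2d})$, with $$\|\mathcal{B}_A(f,g)\|_q\le\frac{\|f\|_p\|g\|_{p'}}{\left|\det\left(M+\frac12I\right)\right|^{\frac1p-\frac1q}\left|\det\left(M-\frac12I\right)\right|^{\frac1{p'}-\frac1q}}.$$ In particular, $\mathcal{B}_A(f,g)$ is bounded (case $q=\infty$). (ii) $\mathcal{B}_A(f,g)\in C_0(\mathbb{R}^{2d})$.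
   Context: For $A\in\mathrm{GL}(2d,\mathbb{R})$ with $d\times d$ blocks $A_{ij}$, $\mathcal{B}_A(f,g)(x,\omega)=\int_{\mathbb{R}^d}e^{-2\pi i\omega\cdot y}f(A_{11}x+A_{12}y)\overline{g(A_{21}x+A_{22}y)}\,dy$. $p'$ denotes the conjugate exponent, $1/p+1/p'=1$ (with $1/\infty=0$). $C_0(\mathbb{R}^{2d})$ is the class of continuous functions vanishing at infinity. *)

theory Defs
  imports "HOL-Analysis.Analysis" "HOL-Probability.Essential_Supremum"
begin

text \<open>Elements of \<open>L\<^sup>p\<close> are represented by functions, not by classes modulo null sets. The
  exponents that matter are \<open>1 \<le> p \<le> \<infinity>\<close>.\<close>

definition Lp_space :: "ereal \<Rightarrow> 'a measure \<Rightarrow> ('a \<Rightarrow> complex) set" where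
  "Lp_space p N = {f \<in> borel_measurable N.
     if p = \<infinity> then esssup N (\<lambda>x. ereal (norm (f x))) < \<infinity>
     else integrable N (\<lambda>x. norm (f x) powr real_of_ereal p)}"

text \<open>The real-valued norm below is meaningful only for \<open>f \<in> Lp_space p N\<close>: elsewhere the integral and
  \<^const>\<open>real_of_ereal\<close> return default values.\<close>

definition Lp_norm :: "ereal \<Rightarrow> 'a measure \<Rightarrow> ('a \<Rightarrow> complex) \<Rightarrow> real" where
  "Lp_norm p N f =
     (if p = \<infinity> then real_of_ereal (esssup N (\<lambda>x. ereal (norm (f x))))
      else (\<integral>x. norm (f x) powr real_of_ereal p \<partial>N) powr (1 / real_of_ereal p))"

definition C0_space :: "('a::euclidean_space \<Rightarrow> complex) set" where
  "C0_space = {F. continuous_on UNIV F \<and> (F \<longlongrightarrow> 0) at_infinity}"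

text \<open>A \<open>2d \<times> 2d\<close> matrix is indexed by the sum type \<open>'n + 'n\<close> with \<open>d = CARD('n)\<close>, so that its
  \<open>d \<times> d\<close> blocks are selected by \<^const>\<open>Inl\<close> (first half) and \<^const>\<open>Inr\<close> (second half). The
  domain \<open>\<real>\<^sup>2\<^sup>d\<close> of the distribution is the product type \<open>(real ^ 'n) \<times> (real ^ 'n)\<close>.\<close>

definition block11 :: "real ^ ('n + 'n) ^ ('n + 'n) \<Rightarrow> real ^ 'n ^ 'n" where
  "block11 A = (\<chi> i j. A $ Inl i $ Inl j)"

definition block12 :: "real ^ ('n + 'n) ^ ('n + 'n) \<Rightarrow> real ^ 'n ^ 'n" where
  "block12 A = (\<chi> i j. A $ Inl i $ Inr j)"

definition block21 :: "real ^ ('n + 'n) ^ ('n + 'n) \<Rightarrow> real ^ 'n ^ 'n" where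
  "block21 A = (\<chi> i j. A $ Inr i $ Inl j)"

definition block22 :: "real ^ ('n + 'n) ^ ('n + 'n) \<Rightarrow> real ^ 'n ^ 'n" where
  "block22 A = (\<chi> i j. A $ Inr i $ Inr j)"

definition block_matrix ::
  "real ^ 'n ^ 'n \<Rightarrow> real ^ 'n ^ 'n \<Rightarrow> real ^ 'n ^ 'n \<Rightarrow> real ^ 'n ^ 'n \<Rightarrow> real ^ ('n + 'n) ^ ('n + 'n)" where
  "block_matrix A11 A12 A21 A22 =
     (\<chi> i j. case i of
        Inl k \<Rightarrow> (case j of Inl l \<Rightarrow> A11 $ k $ l | Inr l \<Rightarrow> A12 $ k $ l)
      | Inr k \<Rightarrow> (case j of Inl l \<Rightarrow> A21 $ k $ l | Inr l \<Rightarrow> A22 $ k $ l))"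

definition A_mat :: "real ^ 'n ^ 'n \<Rightarrow> real ^ ('n + 'n) ^ ('n + 'n)" where
  "A_mat M = block_matrix (mat 1) (M + (1/2) *\<^sub>R mat 1) (mat 1) (M - (1/2) *\<^sub>R mat 1)"

definition B_integrand ::
  "real ^ ('n::finite + 'n) ^ ('n + 'n) \<Rightarrow> (real ^ 'n \<Rightarrow> complex) \<Rightarrow> (real ^ 'n \<Rightarrow> complex)
     \<Rightarrow> real ^ 'n \<Rightarrow> real ^ 'n \<Rightarrow> real ^ 'n \<Rightarrow> complex" where
  "B_integrand A f g x \<omega> y =
     exp (- 2 * complex_of_real pi * \<i> * complex_of_real (\<omega> \<bullet> y))
       * f (block11 A *v x + block12 A *v y) * cnj (g (block21 A *v x + block22 A *v y))"

text \<open>The Bochner integral is \<open>0\<close> for a non-integrable integrand, so convergence has to be asserted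
  separately, through \<^const>\<open>B_integrand\<close>.\<close>

definition B_dist ::
  "real ^ ('n::finite + 'n) ^ ('n + 'n) \<Rightarrow> (real ^ 'n \<Rightarrow> complex) \<Rightarrow> (real ^ 'n \<Rightarrow> complex)
     \<Rightarrow> (real ^ 'n) \<times> (real ^ 'n) \<Rightarrow> complex" where
  "B_dist A f g = (\<lambda>(x, \<omega>). \<integral>y. B_integrand A f g x \<omega> y \<partial>lebesgue)"

end

theory Submission
  imports Defs "HOL-Probability.Characteristic_Functions" "HOL-Complex_Analysis.Conformal_Mappings"
begin

text \<open>
  Write \<open>P = M + I/2\<close> and \<open>Q = M - I/2\<close>. For fixed \<open>x\<close>, the distribution \<open>B(f,g)(x, \<omega>)\<close> is the Fourier
  transform in \<open>y\<close> of the slice \<open>f (x + P y) * cnj (g (x + Q y))\<close>. Two endpoint estimates are direct.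

  \<^item> Boundedness. Hoelder's inequality and the substitutions \<open>x + P y\<close> and \<open>x + Q y\<close> bound the integral
    of the modulus of each slice, hence \<open>\<bar>B(f,g)\<bar>\<close>, by the norms of \<open>f\<close> and \<open>g\<close> in conjugate Lebesgue
    spaces, the exponents \<open>1\<close> and \<open>\<infinity>\<close> included (\<open>slice_Hoelder\<close>, \<open>norm_wigner_le\<close>). This is where
    the determinants of \<open>P\<close> and \<open>Q\<close> enter.
  \<^item> Square integrability. Plancherel's theorem in \<open>\<omega>\<close> reduces the square norm of \<open>B(f,g)\<close> to that of the
    slices, and since \<open>P - Q = I\<close>, Tonelli's theorem evaluates the latter as \<open>\<parallel>f\<parallel>\<^sub>2\<^sup>2 \<parallel>g\<parallel>\<^sub>2\<^sup>2\<close>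
    (\<open>Plancherel_le\<close>, \<open>wigner_L2_le\<close>).

  In the plane of the points \<open>(1/p, 1/q)\<close>, the conditions \<open>2 \<le> q\<close> and \<open>q' \<le> p \<le> q\<close> describe the triangle
  with vertices \<open>(0, 0)\<close>, \<open>(1, 0)\<close> and \<open>(1/2, 1/2)\<close>: its base carries the first estimate and its apex
  the second. The norm bound is therefore a bilinear complex interpolation. It takes the place of a
  passage through the Hausdorff-Young and Young inequalities, and the constants of the two endpoint
  estimates interpolate to exactly the constant claimed. For simple functions the interpolating family is
  a finite exponential sum, to which the three lines theorem applies (\<open>Hadamard_three_lines\<close>,
  \<open>wigner_interpolation_simple\<close>); duality and Fatou's lemma lead from there to all functions in the
  Lebesgue spaces (\<open>wigner_Lq_simple\<close>, \<open>wigner_Lq\<close>).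

  For the second claim, the functions in \<open>C\<^sub>0\<close> are closed under uniform limits, and by the boundedness
  estimate \<open>B(f,g)\<close> is the uniform limit of \<open>B(u,v)\<close> with \<open>u\<close> and \<open>v\<close> continuous of compact
  support. For these, \<open>B(u,v)\<close> vanishes for large \<open>x\<close>, and the argument of the Riemann-Lebesgue lemma
  makes it small for large \<open>\<omega>\<close>, uniformly in \<open>x\<close> (\<open>compact_support_dense\<close>,
  \<open>wigner_compact_support_C0\<close>, \<open>wigner_C0\<close>).

  All of this takes place for Borel functions and \<^const>\<open>lborel\<close>. Lebesgue measurable functions are
  replaced by Borel representatives at the end, which leaves every value of \<open>B(f,g)\<close> unchanged because
  \<open>x + P y\<close> and \<open>x + Q y\<close> pull null sets back to null sets.
\<close>

section \<open>A weighted form of the Hoelder inequality\<close>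

lemma weighted_AM_GM:
  fixes a b s :: real
  assumes "0 \<le> a" "0 \<le> b" "0 \<le> s" "s \<le> 1"
  shows "a powr s * b powr (1 - s) \<le> s * a + (1 - s) * b"
proof (cases "a = 0 \<or> b = 0")
  case True
  then show ?thesis using assms by auto
next
  case False
  then show ?thesis using Youngs_inequality_0[of s "1 - s" a b] assms by simp
qed

text \<open>Hoelder's inequality for the densities \<open>u = \<bar>f\<bar> powr p\<close> and \<open>v = \<bar>g\<bar> powr p'\<close> with \<open>s = 1/p\<close>. This form
  includes the endpoints \<open>s = 0\<close> and \<open>s = 1\<close>, at which the interpolation below uses it. There the
  convention \<open>0 powr 0 = 0\<close> turns one of the factors into the indicator function of the set where the
  density is nonzero, and if that set is null, then both sides are zero.\<close>

lemma weighted_Hoelder: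
  fixes u v :: "'a \<Rightarrow> real"
  assumes u: "integrable N u" and v: "integrable N v"
    and u0: "\<And>x. 0 \<le> u x" and v0: "\<And>x. 0 \<le> v x"
    and s: "0 \<le> s" "s \<le> 1"
  shows "integrable N (\<lambda>x. u x powr s * v x powr (1 - s))"
    and "(\<integral>x. u x powr s * v x powr (1 - s) \<partial>N) \<le> (\<integral>x. u x \<partial>N) powr s * (\<integral>x. v x \<partial>N) powr (1 - s)"
proof -
  note [measurable] = borel_measurable_integrable[OF u] borel_measurable_integrable[OF v]
  let ?w = "\<lambda>x. u x powr s * v x powr (1 - s)"
  let ?U = "\<integral>x. u x \<partial>N" and ?V = "\<integral>x. v x \<partial>N"
  show int: "integrable N ?w"
  proof (rule Bochner_Integration.integrable_bound)
    show "integrable N (\<lambda>x. s * u x + (1 - s) * v x)" using u v by simp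
    show "AE x in N. norm (?w x) \<le> norm (s * u x + (1 - s) * v x)"
      using weighted_AM_GM[OF u0 v0 s] u0 v0 s by (auto simp: abs_mult)
  qed simp
  have U0: "?U \<ge> 0" "?V \<ge> 0" using u0 v0 by auto
  show "integral\<^sup>L N ?w \<le> ?U powr s * ?V powr (1 - s)"
  proof (cases "?U = 0 \<or> ?V = 0")
    case True
    then have "AE x in N. u x = 0 \<or> v x = 0"
    proof
      assume "?U = 0"
      then have "AE x in N. u x = 0" using integral_nonneg_eq_0_iff_AE[OF u] u0 by simp
      then show ?thesis by auto
    next
      assume "?V = 0"
      then have "AE x in N. v x = 0" using integral_nonneg_eq_0_iff_AE[OF v] v0 by simp
      then show ?thesis by auto
    qed
    then have "AE x in N. ?w x = 0" by auto
    then have "integral\<^sup>L N ?w = 0" by (rule integral_eq_zero_AE)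
    then show ?thesis by simp
  next
    case False
    with U0 have pos: "?U > 0" "?V > 0" by auto
    have "?w x \<le> (?U powr s * ?V powr (1 - s)) * (s * (u x / ?U) + (1 - s) * (v x / ?V))" for x
    proof -
      have "?w x = (?U powr s * ?V powr (1 - s)) * ((u x / ?U) powr s * (v x / ?V) powr (1 - s))"
        using pos u0 v0 by (simp add: powr_divide)
      also have "\<dots> \<le> (?U powr s * ?V powr (1 - s)) * (s * (u x / ?U) + (1 - s) * (v x / ?V))"
        by (intro mult_left_mono weighted_AM_GM) (use u0 v0 pos s in auto)
      finally show ?thesis .
    qed
    then have "integral\<^sup>L N ?w \<le> (\<integral>x. (?U powr s * ?V powr (1 - s)) * (s * (u x / ?U) + (1 - s) * (v x / ?V)) \<partial>N)"
      by (intro integral_mono int) (use u v in auto)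
    also have "\<dots> = ?U powr s * ?V powr (1 - s) * (s * (?U / ?U) + (1 - s) * (?V / ?V))"
      using u v by simp
    also have "\<dots> = ?U powr s * ?V powr (1 - s)" using pos by simp
    finally show ?thesis .
  qed
qed

section \<open>Linear change of variables\<close>

lemma nn_integral_lborel_translate:
  fixes c :: "'a::euclidean_space"
  assumes [measurable]: "f \<in> borel_measurable borel"
  shows "(\<integral>\<^sup>+x. f (c + x) \<partial>lborel) = (\<integral>\<^sup>+x. f x \<partial>lborel)"
proof -
  have "(\<integral>\<^sup>+x. f (c + x) \<partial>lborel) = (\<integral>\<^sup>+x. f x \<partial>distr lborel borel ((+) c))"
    by (subst nn_integral_distr) auto
  then show ?thesis by (simp add: lborel_distr_plus)
qed

text \<open>Translation invariance alone shows that a shear preserves Lebesgue measure. The integral does not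
  change if \<open>x\<close> is moved by \<open>s e\<close>, so it may be averaged over \<open>s\<close> in the unit interval; exchanging the
  integrals and substituting \<open>t = s + h x\<close> makes the displacement \<open>t e\<close> independent of \<open>x\<close>, and a
  translation removes it.\<close>

lemma nn_integral_shear:
  fixes f :: "'a::euclidean_space \<Rightarrow> ennreal" and h :: "'a \<Rightarrow> real"
  assumes [measurable]: "f \<in> borel_measurable borel" "h \<in> borel_measurable borel"
    and h: "\<And>t x. h (t *\<^sub>R e + x) = h x"
  shows "(\<integral>\<^sup>+x. f (x + h x *\<^sub>R e) \<partial>lborel) = (\<integral>\<^sup>+x. f x \<partial>lborel)"
proof -
  have h': "h (x + t *\<^sub>R e) = h x" for x t using h[of t x] by (simp add: add.commute)
  \<comment> \<open>Any weight on the line of total mass one would do for the average over \<open>s\<close>.\<close>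
  let ?w = "indicator {0..1::real} :: real \<Rightarrow> ennreal"
  have w: "(\<integral>\<^sup>+s. ?w s \<partial>lborel) = 1" by simp
  have "(\<integral>\<^sup>+x. f (x + h x *\<^sub>R e) \<partial>lborel) = (\<integral>\<^sup>+s. ?w s * (\<integral>\<^sup>+x. f (x + h x *\<^sub>R e) \<partial>lborel) \<partial>lborel)"
    by (subst nn_integral_multc) (simp_all add: w)
  also have "\<dots> = (\<integral>\<^sup>+s. ?w s * (\<integral>\<^sup>+x. f (x + (s + h x) *\<^sub>R e) \<partial>lborel) \<partial>lborel)"
  proof (rule nn_integral_cong, rule arg_cong2[where f="(*)"], rule refl)
    fix s :: real
    show "(\<integral>\<^sup>+x. f (x + h x *\<^sub>R e) \<partial>lborel) = (\<integral>\<^sup>+x. f (x + (s + h x) *\<^sub>R e) \<partial>lborel)"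
      by (subst nn_integral_lborel_translate[of "\<lambda>x. f (x + h x *\<^sub>R e)" "s *\<^sub>R e", symmetric])
         (simp_all add: h h' algebra_simps)
  qed
  also have "\<dots> = (\<integral>\<^sup>+s. (\<integral>\<^sup>+x. ?w s * f (x + (s + h x) *\<^sub>R e) \<partial>lborel) \<partial>lborel)"
    by (intro nn_integral_cong nn_integral_cmult[symmetric]) measurable
  also have "\<dots> = (\<integral>\<^sup>+x. (\<integral>\<^sup>+s. ?w s * f (x + (s + h x) *\<^sub>R e) \<partial>lborel) \<partial>lborel)"
    by (rule lborel_pair.Fubini') measurable
  also have "\<dots> = (\<integral>\<^sup>+x. (\<integral>\<^sup>+t. ?w (t - h x) * f (x + t *\<^sub>R e) \<partial>lborel) \<partial>lborel)"
  proof (rule nn_integral_cong)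
    fix x
    show "(\<integral>\<^sup>+s. ?w s * f (x + (s + h x) *\<^sub>R e) \<partial>lborel) = (\<integral>\<^sup>+t. ?w (t - h x) * f (x + t *\<^sub>R e) \<partial>lborel)"
      by (subst nn_integral_lborel_translate[of "\<lambda>t. ?w (t - h x) * f (x + t *\<^sub>R e)" "h x", symmetric])
         (simp_all add: algebra_simps)
  qed
  also have "\<dots> = (\<integral>\<^sup>+t. (\<integral>\<^sup>+x. ?w (t - h x) * f (x + t *\<^sub>R e) \<partial>lborel) \<partial>lborel)"
    by (rule lborel_pair.Fubini') measurable
  also have "\<dots> = (\<integral>\<^sup>+t. (\<integral>\<^sup>+x. ?w (t - h x) * f x \<partial>lborel) \<partial>lborel)"
  proof (rule nn_integral_cong)
    fix t :: real
    have "(\<integral>\<^sup>+x. ?w (t - h x) * f (x + t *\<^sub>R e) \<partial>lborel)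
        = (\<integral>\<^sup>+x. ?w (t - h (t *\<^sub>R e + x)) * f (t *\<^sub>R e + x) \<partial>lborel)"
      by (simp add: h h' add.commute)
    also have "\<dots> = (\<integral>\<^sup>+x. ?w (t - h x) * f x \<partial>lborel)"
      by (rule nn_integral_lborel_translate) measurable
    finally show "(\<integral>\<^sup>+x. ?w (t - h x) * f (x + t *\<^sub>R e) \<partial>lborel) = (\<integral>\<^sup>+x. ?w (t - h x) * f x \<partial>lborel)" .
  qed
  also have "\<dots> = (\<integral>\<^sup>+x. (\<integral>\<^sup>+t. ?w (t - h x) * f x \<partial>lborel) \<partial>lborel)"
    by (rule lborel_pair.Fubini') measurable
  also have "\<dots> = (\<integral>\<^sup>+x. f x \<partial>lborel)"
  proof (rule nn_integral_cong)
    fix x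
    have "(\<integral>\<^sup>+t. ?w (t - h x) * f x \<partial>lborel) = (\<integral>\<^sup>+t. ?w (t - h x) \<partial>lborel) * f x"
      by (rule nn_integral_multc) measurable
    also have "(\<integral>\<^sup>+t. ?w (t - h x) \<partial>lborel) = (\<integral>\<^sup>+t. ?w t \<partial>lborel)"
      using nn_integral_lborel_translate[of ?w "- h x"] by simp
    finally show "(\<integral>\<^sup>+t. ?w (t - h x) * f x \<partial>lborel) = f x" by (simp add: w)
  qed
  finally show ?thesis .
qed

lemma measurable_matrix_vector_mult[measurable (raw)]:
  fixes P :: "real^'n^'m"
  assumes "g \<in> borel_measurable N"
  shows "(\<lambda>y. P *v g y) \<in> borel_measurable N"
proof -
  have "(*v) P \<in> borel_measurable borel"
    by (intro borel_measurable_continuous_onI linear_continuous_on) (simp add: linear_linear)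
  then show ?thesis using assms by (rule measurable_compose_rev)
qed

text \<open>Every invertible matrix is a product of diagonal matrices, coordinate swaps and shears, and the claim
  is multiplicative in the matrix. Diagonal matrices scale boxes, swaps permute their sides, and shears
  are covered by \<open>nn_integral_shear\<close>.\<close>

lemma nn_integral_linear:
  fixes P :: "real^'n^'n"
  assumes "invertible P" and "f \<in> borel_measurable borel"
  shows "(\<integral>\<^sup>+x. f (P *v x) \<partial>lborel) * ennreal \<bar>det P\<bar> = (\<integral>\<^sup>+x. f x \<partial>lborel)"
proof -
  have "invertible P \<longrightarrow> (\<forall>f\<in>borel_measurable borel.
          (\<integral>\<^sup>+x. f (P *v x) \<partial>lborel) * ennreal \<bar>det P\<bar> = (\<integral>\<^sup>+x. f x \<partial>lborel))"
  proof (induction P rule: induct_matrix_elementary)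
    case (1 A B)
    show ?case
    proof (intro impI ballI)
      fix f :: "real^'n \<Rightarrow> ennreal"
      assume inv: "invertible (A ** B)" and f[measurable]: "f \<in> borel_measurable borel"
      have inv': "invertible A" "invertible B"
        using inv by (auto simp: invertible_det_nz det_mul)
      have "(\<integral>\<^sup>+x. f ((A ** B) *v x) \<partial>lborel) * ennreal \<bar>det (A ** B)\<bar>
          = ((\<integral>\<^sup>+x. (\<lambda>y. f (A *v y)) (B *v x) \<partial>lborel) * ennreal \<bar>det B\<bar>) * ennreal \<bar>det A\<bar>"
        by (simp add: matrix_vector_mul_assoc det_mul abs_mult ennreal_mult mult_ac)
      also have "(\<integral>\<^sup>+x. (\<lambda>y. f (A *v y)) (B *v x) \<partial>lborel) * ennreal \<bar>det B\<bar> = (\<integral>\<^sup>+y. f (A *v y) \<partial>lborel)"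
        using 1(2) inv'(2) by (intro bspec[where x="\<lambda>y. f (A *v y)"]) (auto, measurable)
      also have "\<dots> * ennreal \<bar>det A\<bar> = (\<integral>\<^sup>+x. f x \<partial>lborel)"
        using 1(1) inv' f by blast
      finally show "(\<integral>\<^sup>+x. f ((A ** B) *v x) \<partial>lborel) * ennreal \<bar>det (A ** B)\<bar> = (\<integral>\<^sup>+x. f x \<partial>lborel)" .
    qed
  next
    case (2 A i)
    then have "det A = 0" by (simp add: det_zero_row(2))
    then show ?case by (simp add: invertible_det_nz)
  next
    case (3 A)
    show ?case
    proof (intro impI ballI)
      fix f :: "real^'n \<Rightarrow> ennreal"
      assume inv: "invertible A" and f[measurable]: "f \<in> borel_measurable borel"
      define c where "c = (\<lambda>b::real^'n. (A *v b) \<bullet> b)"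
      have detA: "det A = (\<Prod>i\<in>UNIV. A $ i $ i)" using 3 by (rule det_diagonal)
      have c_axis: "c (axis i 1) = A $ i $ i" for i
        by (simp add: c_def matrix_vector_mul_component inner_axis' inner_axis)
      have Basis: "Basis = (\<lambda>i. axis i 1 :: real^'n) ` UNIV"
        by (auto simp: Basis_vec_def)
      have inj: "inj (\<lambda>i. axis i 1 :: real^'n)" by (auto simp: inj_on_def axis_eq_axis)
      have prod: "(\<Prod>j\<in>Basis. \<bar>c j\<bar>) = \<bar>det A\<bar>"
        unfolding Basis by (subst prod.reindex[OF inj]) (simp add: c_axis detA abs_prod)
      have nz: "c j \<noteq> 0" if "j \<in> Basis" for j
        using inv that by (auto simp: invertible_det_nz detA Basis c_axis)
      have T: "0 + (\<Sum>j\<in>Basis. (c j * (x \<bullet> j)) *\<^sub>R j) = A *v x" for x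
      proof -
        have "(\<Sum>j\<in>Basis. (c j * (x \<bullet> j)) *\<^sub>R j) = (\<Sum>i\<in>UNIV. (A $ i $ i * x $ i) *\<^sub>R axis i 1)"
          unfolding Basis by (subst sum.reindex[OF inj]) (simp add: c_axis inner_axis)
        also have "\<dots> = A *v x"
        proof (subst vec_eq_iff, intro allI)
          fix k
          have "(A *v x) $ k = (\<Sum>j\<in>UNIV. A $ k $ j * x $ j)" by (simp add: matrix_vector_mult_def)
          also have "\<dots> = (\<Sum>j\<in>UNIV. if j = k then A $ k $ k * x $ k else 0)"
            using 3 by (intro sum.cong) auto
          finally show "(\<Sum>i\<in>UNIV. (A $ i $ i * x $ i) *\<^sub>R axis i 1) $ k = (A *v x) $ k"
            by (simp add: axis_def if_distrib cong: if_cong)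
        qed
        finally show ?thesis by simp
      qed
      have "(\<integral>\<^sup>+x. f x \<partial>lborel)
          = (\<integral>\<^sup>+x. f x \<partial>density (distr lborel borel (\<lambda>x. 0 + (\<Sum>j\<in>Basis. (c j * (x \<bullet> j)) *\<^sub>R j))) (\<lambda>_. \<Prod>j\<in>Basis. \<bar>c j\<bar>))"
        using lborel_affine_euclidean[of c 0] nz by simp
      also have "\<dots> = (\<integral>\<^sup>+x. f x \<partial>density (distr lborel borel (\<lambda>x. A *v x)) (\<lambda>_. ennreal \<bar>det A\<bar>))"
        by (simp only: T prod)
      also have "\<dots> = (\<integral>\<^sup>+x. f (A *v x) \<partial>lborel) * ennreal \<bar>det A\<bar>"
        by (simp add: nn_integral_density nn_integral_distr nn_integral_cmult mult.commute)
      finally show "(\<integral>\<^sup>+x. f (A *v x) \<partial>lborel) * ennreal \<bar>det A\<bar> = (\<integral>\<^sup>+x. f x \<partial>lborel)" by simp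
    qed
  next
    case (4 m n)
    let ?S = "\<chi> i j. mat 1 $ i $ Transposition.transpose m n j :: real^'n^'n"
    let ?\<tau> = "Transposition.transpose m n"
    have S: "?S *v x = (\<chi> i. x $ ?\<tau> i)" for x
    proof -
      have "(\<Sum>j\<in>UNIV. (if i = ?\<tau> j then 1 else 0) * x $ j) = x $ ?\<tau> i" for i
      proof -
        have "(\<Sum>j\<in>UNIV. (if i = ?\<tau> j then 1 else 0) * x $ j) = (\<Sum>j\<in>UNIV. if j = ?\<tau> i then x $ j else 0)"
          by (intro sum.cong) auto
        then show ?thesis by simp
      qed
      then show ?thesis by (simp add: vec_eq_iff matrix_vector_mult_def mat_def)
    qed
    have det: "\<bar>det ?S\<bar> = 1"
      using det_permute_columns[of ?\<tau> "mat 1 :: real^'n^'n"] permutes_swap_id[of m UNIV n]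
      by (simp add: abs_mult sign_def)
    have Sm[measurable]: "(\<lambda>x::real^'n. \<chi> i. x $ ?\<tau> i) \<in> borel_measurable borel"
    proof -
      have "(\<lambda>x::real^'n. \<chi> i. x $ ?\<tau> i) = (\<lambda>x. ?S *v x)" by (rule ext) (rule S[symmetric])
      then show ?thesis by simp
    qed
    have invariant: "lborel = distr lborel borel (\<lambda>x::real^'n. \<chi> i. x $ ?\<tau> i)"
    proof (rule lborel_eqI)
      fix l u :: "real^'n"
      assume lu: "\<And>b. b \<in> Basis \<Longrightarrow> l \<bullet> b \<le> u \<bullet> b"
      have Basis: "Basis = (\<lambda>i. axis i 1 :: real^'n) ` UNIV"
        by (auto simp: Basis_vec_def)
      have lu': "l $ i \<le> u $ i" for i using lu[of "axis i 1"] by (simp add: Basis inner_axis)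
      have inj: "inj (\<lambda>i. axis i 1 :: real^'n)" by (auto simp: inj_on_def axis_eq_axis)
      have pr: "(\<Prod>b\<in>Basis. w \<bullet> b) = (\<Prod>i\<in>UNIV. w $ i)" for w :: "real^'n"
        unfolding Basis by (subst prod.reindex[OF inj]) (simp add: inner_axis)
      let ?l = "\<chi> i. l $ ?\<tau> i" and ?u = "\<chi> i. u $ ?\<tau> i"
      have "(\<lambda>x. \<chi> i. x $ ?\<tau> i) -` box l u = box ?l ?u"
      proof -
        have reindex: "(\<forall>i. R (?\<tau> i) i) \<longleftrightarrow> (\<forall>i. R i (?\<tau> i))" for R
        proof
          assume *: "\<forall>i. R (?\<tau> i) i"
          show "\<forall>i. R i (?\<tau> i)"
          proof
            fix i show "R i (?\<tau> i)" using spec[OF *, of "?\<tau> i"] by simp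
          qed
        next
          assume *: "\<forall>i. R i (?\<tau> i)"
          show "\<forall>i. R (?\<tau> i) i"
          proof
            fix i show "R (?\<tau> i) i" using spec[OF *, of "?\<tau> i"] by simp
          qed
        qed
        show ?thesis
          using reindex[of "\<lambda>i j. l $ j < x $ i \<and> x $ i < u $ j" for x] by (auto simp: mem_box_cart)
      qed
      then have "emeasure (distr lborel borel (\<lambda>x::real^'n. \<chi> i. x $ ?\<tau> i)) (box l u) = emeasure lborel (box ?l ?u)"
        by (simp add: emeasure_distr)
      also have "\<dots> = (\<Prod>b\<in>Basis. (?u - ?l) \<bullet> b)"
        by (rule emeasure_lborel_box) (auto simp: Basis inner_axis lu')
      also have "\<dots> = (\<Prod>i\<in>UNIV. u $ ?\<tau> i - l $ ?\<tau> i)" by (simp add: pr)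
      also have "\<dots> = (\<Prod>i\<in>UNIV. u $ i - l $ i)"
        using prod.reindex_bij_betw[of "?\<tau>" UNIV UNIV "\<lambda>i. u $ i - l $ i"] by simp
      also have "\<dots> = (\<Prod>b\<in>Basis. (u - l) \<bullet> b)" by (simp add: pr)
      finally show "emeasure (distr lborel borel (\<lambda>x::real^'n. \<chi> i. x $ ?\<tau> i)) (box l u) = (\<Prod>b\<in>Basis. (u - l) \<bullet> b)" .
    qed simp
    have "(\<integral>\<^sup>+x. f (\<chi> i. x $ ?\<tau> i) \<partial>lborel) = (\<integral>\<^sup>+x. f x \<partial>lborel)"
      if [measurable]: "f \<in> borel_measurable borel" for f :: "real^'n \<Rightarrow> ennreal"
      by (subst (2) invariant, subst nn_integral_distr) auto
    then show ?case by (simp add: S det)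
  next
    case (5 m n c)
    let ?E = "\<chi> i j. if i = m \<and> j = n then c else of_bool (i = j) :: real^'n^'n"
    have E: "?E *v x = x + (c * x $ n) *\<^sub>R axis m 1" for x
    proof -
      have "(\<Sum>j\<in>UNIV. (if i = m \<and> j = n then c else of_bool (i = j)) * x $ j)
          = x $ i + (if i = m then c * x $ n else 0)" for i
      proof -
        have "(\<Sum>j\<in>UNIV. (if i = m \<and> j = n then c else of_bool (i = j)) * x $ j)
            = (\<Sum>j\<in>UNIV. (if j = i then x $ i else 0) + (if j = n then (if i = m then c * x $ n else 0) else 0))"
          using 5 by (intro sum.cong) auto
        then show ?thesis by (simp add: sum.distrib)
      qed
      then show ?thesis by (simp add: vec_eq_iff matrix_vector_mult_def axis_def)
    qed
    have "det ?E = det (\<chi> k. if k = m then row m (mat 1) + c *s row n (mat 1) else row k (mat 1 :: real^'n^'n))"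
      using 5 by (intro arg_cong[where f=det]) (auto simp: vec_eq_iff row_def mat_def)
    also have "\<dots> = 1" using 5 by (simp add: det_row_operation)
    finally have det: "det ?E = 1" .
    have "(\<integral>\<^sup>+x. f (x + (c * x $ n) *\<^sub>R axis m 1) \<partial>lborel) = (\<integral>\<^sup>+x. f x \<partial>lborel)"
      if "f \<in> borel_measurable borel" for f :: "real^'n \<Rightarrow> ennreal"
      using that 5 by (intro nn_integral_shear) (auto simp: axis_def)
    then show ?case by (simp add: E det)
  qed
  then show ?thesis using assms by blast
qed

lemma distr_lborel_affine:
  fixes P :: "real^'n^'n"
  assumes P: "invertible P"
  shows "distr lborel borel (\<lambda>y. x + P *v y) = density lborel (\<lambda>_. ennreal (1 / \<bar>det P\<bar>))"
proof (rule measure_eqI)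
  have det: "det P \<noteq> 0" using P invertible_det_nz by blast
  fix A assume "A \<in> sets (distr lborel borel (\<lambda>y. x + P *v y))"
  then have A[measurable]: "A \<in> sets borel" by simp
  have "emeasure lborel A = (\<integral>\<^sup>+y. indicator A (x + y) \<partial>lborel)"
    by (subst nn_integral_lborel_translate) auto
  also have "\<dots> = (\<integral>\<^sup>+y. indicator A (x + P *v y) \<partial>lborel) * ennreal \<bar>det P\<bar>"
    by (subst nn_integral_linear[OF P, symmetric]) auto
  also have "(\<integral>\<^sup>+y. indicator A (x + P *v y) \<partial>lborel) = (\<integral>\<^sup>+y. indicator A y \<partial>distr lborel borel (\<lambda>y. x + P *v y))"
    by (subst nn_integral_distr) auto
  also have "\<dots> = emeasure (distr lborel borel (\<lambda>y. x + P *v y)) A"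
    by simp
  finally have "emeasure lborel A * ennreal (1 / \<bar>det P\<bar>)
      = emeasure (distr lborel borel (\<lambda>y. x + P *v y)) A * (ennreal \<bar>det P\<bar> * ennreal (1 / \<bar>det P\<bar>))"
    by (simp add: mult.assoc)
  also have "ennreal \<bar>det P\<bar> * ennreal (1 / \<bar>det P\<bar>) = 1"
    using det by (simp flip: ennreal_mult)
  finally show "emeasure (distr lborel borel (\<lambda>y. x + P *v y)) A
      = emeasure (density lborel (\<lambda>_. ennreal (1 / \<bar>det P\<bar>))) A"
    by (simp add: emeasure_density mult.commute[of _ "ennreal _"] nn_integral_cmult_indicator)
qed simp

lemma integral_affine:
  fixes P :: "real^'n^'n" and f :: "real^'n \<Rightarrow> 'b :: {banach, second_countable_topology}"
  assumes P: "invertible P" and f[measurable]: "f \<in> borel_measurable borel"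
  shows "integrable lborel (\<lambda>y. f (x + P *v y)) \<longleftrightarrow> integrable lborel f"
    and "(\<integral>y. f (x + P *v y) \<partial>lborel) = (\<integral>y. f y \<partial>lborel) /\<^sub>R \<bar>det P\<bar>"
proof -
  have det: "det P \<noteq> 0" using P invertible_det_nz by blast
  have "integrable lborel (\<lambda>y. f (x + P *v y)) \<longleftrightarrow> integrable (distr lborel borel (\<lambda>y. x + P *v y)) f"
    by (subst integrable_distr_eq) auto
  also have "\<dots> \<longleftrightarrow> integrable lborel f"
  proof -
    have "integrable lborel f" if "integrable lborel (\<lambda>x. (1 / \<bar>det P\<bar>) *\<^sub>R f x)"
      using integrable_scaleR_right[OF that, of "\<bar>det P\<bar>"] det by simp
    then show ?thesis unfolding distr_lborel_affine[OF P] using det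
      by (subst integrable_density) auto
  qed
  finally show "integrable lborel (\<lambda>y. f (x + P *v y)) \<longleftrightarrow> integrable lborel f" .
  have "(\<integral>y. f (x + P *v y) \<partial>lborel) = integral\<^sup>L (distr lborel borel (\<lambda>y. x + P *v y)) f"
    by (subst integral_distr) auto
  also have "\<dots> = (\<integral>y. f y \<partial>lborel) /\<^sub>R \<bar>det P\<bar>"
    unfolding distr_lborel_affine[OF P] using det by (subst integral_density) (auto simp: divide_inverse)
  finally show "(\<integral>y. f (x + P *v y) \<partial>lborel) = (\<integral>y. f y \<partial>lborel) /\<^sub>R \<bar>det P\<bar>" .
qed

lemma AE_affine:
  fixes P :: "real^'n^'n"
  assumes P: "invertible P" and "AE y in lborel. R y"
  shows "AE y in lborel. R (x + P *v y)"
proof -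
  have "AE y in density lborel (\<lambda>_. ennreal (1 / \<bar>det P\<bar>)). R y"
    using assms(2) by (subst AE_density) auto
  then have "AE y in distr lborel borel (\<lambda>y. x + P *v y). R y"
    unfolding distr_lborel_affine[OF P] .
  then show ?thesis by (rule AE_distrD[rotated]) simp
qed

section \<open>The Fourier transform contracts the square norm\<close>

text \<open>The form in which Fatou's lemma is used throughout: a bound on the integrals of nonnegative functions
  survives pointwise limits.\<close>

lemma nn_integral_Fatou_bound:
  fixes u :: "nat \<Rightarrow> 'a \<Rightarrow> real"
  assumes [measurable]: "\<And>n. u n \<in> borel_measurable N"
    and lim: "\<And>x. x \<in> space N \<Longrightarrow> (\<lambda>n. u n x) \<longlonglongrightarrow> v x"
    and bound: "\<And>n. (\<integral>\<^sup>+x. ennreal (u n x) \<partial>N) \<le> c n" and c: "c \<longlonglongrightarrow> C"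
  shows "(\<integral>\<^sup>+x. ennreal (v x) \<partial>N) \<le> C"
proof -
  have "(\<integral>\<^sup>+x. ennreal (v x) \<partial>N) = (\<integral>\<^sup>+x. liminf (\<lambda>n. ennreal (u n x)) \<partial>N)"
  proof (rule nn_integral_cong)
    fix x assume "x \<in> space N"
    then have "(\<lambda>n. ennreal (u n x)) \<longlonglongrightarrow> ennreal (v x)" using lim by (intro tendsto_ennrealI)
    then show "ennreal (v x) = liminf (\<lambda>n. ennreal (u n x))"
      by (simp add: lim_imp_Liminf)
  qed
  also have "\<dots> \<le> liminf (\<lambda>n. \<integral>\<^sup>+x. ennreal (u n x) \<partial>N)"
    by (rule nn_integral_liminf) measurable
  also have "\<dots> \<le> liminf c" by (rule Liminf_mono) (simp add: bound)
  also have "\<dots> = C" using c by (simp add: lim_imp_Liminf)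
  finally show ?thesis .
qed

lemma integrable_tensor:
  fixes f :: "'a \<Rightarrow> 'c::{real_normed_field,banach,second_countable_topology}"
  assumes "sigma_finite_measure M" "sigma_finite_measure N"
    and f: "integrable M f" and g: "integrable N g"
  shows "integrable (M \<Otimes>\<^sub>M N) (\<lambda>(x, y). f x * g y)"
proof -
  interpret M: sigma_finite_measure M by fact
  interpret N: sigma_finite_measure N by fact
  interpret pair_sigma_finite M N ..
  note [measurable] = borel_measurable_integrable[OF f] borel_measurable_integrable[OF g]
  show ?thesis
    by (rule Fubini_integrable) (use f g in \<open>auto simp: norm_mult\<close>)
qed

lemma integral_lborel_prod:
  fixes f :: "'a::euclidean_space \<Rightarrow> real \<Rightarrow> complex"
  assumes f: "\<And>b. b \<in> Basis \<Longrightarrow> integrable lborel (f b)"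
  shows "integrable lborel (\<lambda>x::'a. \<Prod>b\<in>Basis. f b (x \<bullet> b))"
    and "(\<integral>x. (\<Prod>b\<in>Basis. f b (x \<bullet> b)) \<partial>lborel) = (\<Prod>b\<in>Basis. \<integral>t. f b t \<partial>lborel)"
proof -
  interpret product_sigma_finite "\<lambda>_::'a. lborel :: real measure" ..
  have m: "f b \<in> borel_measurable borel" if "b \<in> Basis" for b
    using borel_measurable_integrable[OF f[OF that]] by simp
  have [measurable]: "(\<lambda>x::'a. \<Prod>b\<in>Basis. f b (x \<bullet> b)) \<in> borel_measurable borel"
    by (intro borel_measurable_prod measurable_compose[OF _ m]) auto
  have S[measurable]: "(\<lambda>f. \<Sum>b\<in>Basis. f b *\<^sub>R b) \<in> (\<Pi>\<^sub>M b\<in>(Basis::'a set). lborel) \<rightarrow>\<^sub>M borel"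
    by measurable
  have eq: "(\<Prod>b\<in>Basis. f b ((\<Sum>c\<in>Basis. x c *\<^sub>R c) \<bullet> b)) = (\<Prod>b\<in>Basis. f b (x b))" for x
    by (intro prod.cong) auto
  show "integrable lborel (\<lambda>x::'a. \<Prod>b\<in>Basis. f b (x \<bullet> b))"
    by (subst lborel_eq, subst integrable_distr_eq) (auto simp: eq intro!: product_integrable_prod f)
  show "(\<integral>x. (\<Prod>b\<in>Basis. f b (x \<bullet> b)) \<partial>lborel) = (\<Prod>b\<in>Basis. \<integral>t. f b t \<partial>lborel)"
    by (subst lborel_eq, subst integral_distr) (auto simp: eq intro!: product_integral_prod f)
qed

lemma borel_measurable_cis[measurable (raw)]:
  "g \<in> borel_measurable N \<Longrightarrow> (\<lambda>x. cis (g x)) \<in> borel_measurable N"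
  unfolding cis_conv_exp by measurable

text \<open>A rescaling of the characteristic function of the standard normal distribution. The transform of a
  Gaussian is again a normal density, so it is nonnegative with total mass one; Plancherel's
  inequality rests on these two properties.\<close>

lemma fourier_gaussian_real:
  assumes "\<sigma> > 0"
  shows "integrable lborel (\<lambda>t. cis (- (2 * pi * (t * u))) * complex_of_real (exp (- (\<sigma> * t)\<^sup>2 / 2)))"
    and "(\<integral>t. cis (- (2 * pi * (t * u))) * complex_of_real (exp (- (\<sigma> * t)\<^sup>2 / 2)) \<partial>lborel)
       = complex_of_real (normal_density 0 (\<sigma> / (2 * pi)) u)"
proof -
  define s where "s = - (2 * pi * u) / \<sigma>"
  let ?h = "\<lambda>x. cis (s * x) * complex_of_real (std_normal_density x)"
  have int_n: "integrable lborel std_normal_density"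
    using integrable_normal_density[of 1 0] by simp
  have int: "integrable lborel ?h"
    by (rule Bochner_Integration.integrable_bound[OF int_n]) (auto simp: norm_mult)
  have "complex_of_real (exp (- (s^2) / 2)) = char std_normal_distribution s"
    by (simp add: char_std_normal_distribution)
  also have "\<dots> = (\<integral>x. ?h x \<partial>lborel)"
    unfolding char_def
    by (subst integral_density) (auto simp: cis_conv_exp scaleR_conv_of_real mult_ac)
  also have "\<dots> = \<bar>\<sigma>\<bar> *\<^sub>R (\<integral>t. ?h (0 + \<sigma> * t) \<partial>lborel)"
    by (rule lborel_integral_real_affine) (use assms in simp)
  finally have 1: "complex_of_real (exp (- (s^2) / 2)) = \<bar>\<sigma>\<bar> *\<^sub>R (\<integral>t. ?h (0 + \<sigma> * t) \<partial>lborel)" .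
  have h: "?h (0 + \<sigma> * t) = (1 / sqrt (2 * pi)) *\<^sub>R (cis (- (2 * pi * (t * u))) * complex_of_real (exp (- (\<sigma> * t)\<^sup>2 / 2)))" for t
    using assms by (simp add: s_def std_normal_density_def scaleR_conv_of_real field_simps)
  have int2: "integrable lborel (\<lambda>t. ?h (0 + \<sigma> * t))"
    by (rule lborel_integrable_real_affine[OF int]) (use assms in simp)
  have "integrable lborel (\<lambda>t. sqrt (2 * pi) *\<^sub>R ?h (0 + \<sigma> * t))"
    using int2 by (rule integrable_scaleR_right)
  then show "integrable lborel (\<lambda>t. cis (- (2 * pi * (t * u))) * complex_of_real (exp (- (\<sigma> * t)\<^sup>2 / 2)))"
    unfolding h by simp
  let ?I = "\<integral>t. cis (- (2 * pi * (t * u))) * complex_of_real (exp (- (\<sigma> * t)\<^sup>2 / 2)) \<partial>lborel"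
  have "complex_of_real (exp (- (s^2) / 2)) = (\<sigma> / sqrt (2 * pi)) *\<^sub>R ?I"
    using 1 assms unfolding h by simp
  then have "?I = complex_of_real (sqrt (2 * pi) / \<sigma> * exp (- (s^2) / 2))"
    using assms by (simp add: scaleR_conv_of_real field_simps)
  also have "sqrt (2 * pi) / \<sigma> * exp (- (s^2) / 2) = normal_density 0 (\<sigma> / (2 * pi)) u"
  proof -
    have "sqrt (2 * pi * (\<sigma> / (2 * pi))\<^sup>2) = sqrt (2 * pi) * (\<sigma> / (2 * pi))"
      using assms by (simp add: real_sqrt_mult)
    also have "\<dots> = \<sigma> / sqrt (2 * pi)"
      by (simp add: field_simps flip: power2_eq_square)
    finally have "1 / sqrt (2 * pi * (\<sigma> / (2 * pi))\<^sup>2) = sqrt (2 * pi) / \<sigma>" by simp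
    moreover have "- (s^2) / 2 = - (u - 0)\<^sup>2 / (2 * (\<sigma> / (2 * pi))\<^sup>2)"
      using assms by (simp add: s_def field_simps power2_eq_square)
    ultimately show ?thesis by (simp only: normal_density_def)
  qed
  finally show "?I = complex_of_real (normal_density 0 (\<sigma> / (2 * pi)) u)" .
qed

lemma borel_measurable_cnj[measurable (raw)]:
  "g \<in> borel_measurable N \<Longrightarrow> (\<lambda>x. cnj (g x)) \<in> borel_measurable N"
  by (rule borel_measurable_continuous_on) (intro continuous_intros)

text \<open>The Fourier transform of \<open>exp (-(\<sigma> \<bar>\<omega>\<bar>)\<^sup>2/2)\<close>: the density of independent centred normal variables with
  standard deviation \<open>\<sigma>/(2\<pi>)\<close>.\<close>

definition gaussian_kernel :: "real \<Rightarrow> 'a::euclidean_space \<Rightarrow> real" where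
  "gaussian_kernel \<sigma> u = (\<Prod>b\<in>Basis. normal_density 0 (\<sigma> / (2 * pi)) (u \<bullet> b))"

lemma gaussian_kernel_nonneg[simp]: "gaussian_kernel \<sigma> u \<ge> 0"
  by (simp add: gaussian_kernel_def prod_nonneg)

lemma gaussian_kernel_minus: "gaussian_kernel \<sigma> (- u) = gaussian_kernel \<sigma> u"
  by (simp add: gaussian_kernel_def normal_density_def)

lemma borel_measurable_gaussian_kernel[measurable]: "gaussian_kernel \<sigma> \<in> borel_measurable borel"
  unfolding gaussian_kernel_def by measurable

lemma nn_integral_gaussian_kernel:
  fixes x :: "'a::euclidean_space"
  assumes "\<sigma> > 0"
  shows "(\<integral>\<^sup>+y. ennreal (gaussian_kernel \<sigma> (y - x)) \<partial>lborel) = 1"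
proof -
  have 1: "(\<integral>\<^sup>+t. ennreal (normal_density 0 (\<sigma> / (2 * pi)) t) \<partial>lborel) = 1"
    by (subst nn_integral_eq_integral) (use assms in auto)
  have "(\<integral>\<^sup>+y. ennreal (gaussian_kernel \<sigma> (- x + y)) \<partial>lborel) = (\<integral>\<^sup>+(y::'a). ennreal (gaussian_kernel \<sigma> y) \<partial>lborel)"
    by (rule nn_integral_lborel_translate) measurable
  also have "\<dots> = (\<integral>\<^sup>+(y::'a). (\<Prod>b\<in>Basis. ennreal (normal_density 0 (\<sigma> / (2 * pi)) (y \<bullet> b))) \<partial>lborel)"
    by (simp add: gaussian_kernel_def prod_ennreal)
  also have "\<dots> = (\<Prod>b\<in>(Basis::'a set). (\<integral>\<^sup>+t. ennreal (normal_density 0 (\<sigma> / (2 * pi)) t) \<partial>lborel))"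
    by (rule nn_integral_lborel_prod) auto
  also have "\<dots> = 1" by (simp add: 1)
  finally show ?thesis by simp
qed

lemma cis_sum: "finite A \<Longrightarrow> cis (\<Sum>i\<in>A. f i) = (\<Prod>i\<in>A. cis (f i))"
  by (induction A rule: finite_induct) (auto simp: cis_mult[symmetric])

lemma fourier_gaussian:
  fixes u :: "'a::euclidean_space"
  assumes "\<sigma> > 0"
  shows "integrable lborel (\<lambda>\<omega>. cis (- (2 * pi * (\<omega> \<bullet> u))) * complex_of_real (exp (- (\<sigma> * norm \<omega>)\<^sup>2 / 2)))"
    and "(\<integral>\<omega>. cis (- (2 * pi * (\<omega> \<bullet> u))) * complex_of_real (exp (- (\<sigma> * norm \<omega>)\<^sup>2 / 2)) \<partial>lborel)
       = complex_of_real (gaussian_kernel \<sigma> u)"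
proof -
  let ?f = "\<lambda>b t. cis (- (2 * pi * (t * (u \<bullet> b)))) * complex_of_real (exp (- (\<sigma> * t)\<^sup>2 / 2))"
  have eq: "(\<Prod>b\<in>Basis. ?f b (\<omega> \<bullet> b)) = cis (- (2 * pi * (\<omega> \<bullet> u))) * complex_of_real (exp (- (\<sigma> * norm \<omega>)\<^sup>2 / 2))" for \<omega>
  proof -
    have "(\<Prod>b\<in>Basis. ?f b (\<omega> \<bullet> b)) = cis (\<Sum>b\<in>Basis. - (2 * pi * ((\<omega> \<bullet> b) * (u \<bullet> b))))
        * complex_of_real (exp (\<Sum>b\<in>Basis. - (\<sigma> * (\<omega> \<bullet> b))\<^sup>2 / 2))"
      by (simp only: prod.distrib cis_sum[OF finite_Basis] exp_sum[OF finite_Basis] of_real_prod)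
    also have "(\<Sum>b\<in>Basis. - (2 * pi * ((\<omega> \<bullet> b) * (u \<bullet> b)))) = - (2 * pi * (\<omega> \<bullet> u))"
      by (subst (3) euclidean_inner) (simp add: sum_negf sum_distrib_left)
    also have "(\<Sum>b\<in>Basis. - (\<sigma> * (\<omega> \<bullet> b))\<^sup>2 / 2) = - (\<sigma> * norm \<omega>)\<^sup>2 / 2"
    proof -
      have "(norm \<omega>)\<^sup>2 = (\<Sum>b\<in>Basis. (\<omega> \<bullet> b)\<^sup>2)"
        unfolding power2_norm_eq_inner by (subst euclidean_inner) (simp add: power2_eq_square)
      then show ?thesis by (simp add: power_mult_distrib sum_negf sum_distrib_left sum_divide_distrib)
    qed
    finally show ?thesis .
  qed
  show "integrable lborel (\<lambda>\<omega>. cis (- (2 * pi * (\<omega> \<bullet> u))) * complex_of_real (exp (- (\<sigma> * norm \<omega>)\<^sup>2 / 2)))"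
    using integral_lborel_prod(1)[of ?f] fourier_gaussian_real(1)[OF assms] by (simp only: eq)
  show "(\<integral>\<omega>. cis (- (2 * pi * (\<omega> \<bullet> u))) * complex_of_real (exp (- (\<sigma> * norm \<omega>)\<^sup>2 / 2)) \<partial>lborel)
       = complex_of_real (gaussian_kernel \<sigma> u)"
    using integral_lborel_prod(2)[of ?f] fourier_gaussian_real[OF assms]
    by (simp only: eq gaussian_kernel_def of_real_prod)
qed

definition fourier :: "('a::euclidean_space \<Rightarrow> complex) \<Rightarrow> 'a \<Rightarrow> complex" where
  "fourier F \<omega> = (\<integral>y. cis (- (2 * pi * (\<omega> \<bullet> y))) * F y \<partial>lborel)"

lemma integrable_fourier:
  assumes "integrable lborel F"
  shows "integrable lborel (\<lambda>y. cis (- (2 * pi * (\<omega> \<bullet> y))) * F y)"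
proof -
  note [measurable] = borel_measurable_integrable[OF assms, simplified]
  show ?thesis
    by (rule Bochner_Integration.integrable_bound[OF assms]) (auto simp: norm_mult)
qed

text \<open>The factor \<open>exp (-\<sigma>\<^sup>2\<bar>\<omega>\<bar>\<^sup>2/2)\<close> makes \<open>\<bar>fourier F\<bar>\<^sup>2\<close> integrable. Expanding the square and integrating in
  \<open>\<omega>\<close> first leaves the double integral of \<open>F y * cnj (F y')\<close> against the Gaussian kernel at
  \<open>y - y'\<close>. As \<open>\<bar>F y\<bar> \<bar>F y'\<bar>\<close> is at most the mean of the squares and the kernel has mass one in each
  variable, this is at most the integral of \<open>\<bar>F\<bar>\<^sup>2\<close>.\<close>

lemma gaussian_Plancherel_le:
  fixes F :: "'a::euclidean_space \<Rightarrow> complex"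
  assumes F: "integrable lborel F" and \<sigma>: "\<sigma> > 0"
  shows "(\<integral>\<^sup>+\<omega>. ennreal (exp (- (\<sigma> * norm \<omega>)\<^sup>2 / 2) * (norm (fourier F \<omega>))\<^sup>2) \<partial>lborel)
     \<le> (\<integral>\<^sup>+y. ennreal ((norm (F y))\<^sup>2) \<partial>lborel)"
proof -
  note [measurable] = borel_measurable_integrable[OF F, simplified]
  let ?W = "\<lambda>\<omega>::'a. exp (- (\<sigma> * norm \<omega>)\<^sup>2 / 2)"
  let ?K = "\<lambda>z. F (fst z) * cnj (F (snd z))"
  let ?H = "\<lambda>\<omega> z. cis (- (2 * pi * (\<omega> \<bullet> (fst z - snd z)))) * complex_of_real (?W \<omega>) * ?K z"
  have W: "integrable lborel (\<lambda>\<omega>. complex_of_real (?W \<omega>))"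
    using fourier_gaussian(1)[OF \<sigma>, of "0::'a"] by simp
  have K: "integrable lborel ?K"
    using integrable_tensor[OF sigma_finite_lborel sigma_finite_lborel F integrable_cnj[OF F]]
    by (simp add: lborel_prod case_prod_beta')
  have H: "integrable (lborel \<Otimes>\<^sub>M lborel) (\<lambda>(\<omega>, z). ?H \<omega> z)"
  proof (rule Bochner_Integration.integrable_bound)
    show "integrable (lborel \<Otimes>\<^sub>M lborel) (\<lambda>(\<omega>, z). complex_of_real (?W \<omega>) * ?K z)"
      by (rule integrable_tensor[OF sigma_finite_lborel sigma_finite_lborel W K])
    have "(\<lambda>(\<omega>, z). ?H \<omega> z) \<in> borel_measurable (lborel \<Otimes>\<^sub>M (lborel \<Otimes>\<^sub>M lborel))"
      by measurable
    then show "(\<lambda>(\<omega>, z). ?H \<omega> z) \<in> borel_measurable (lborel \<Otimes>\<^sub>M lborel)"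
      by (simp only: lborel_prod)
  qed (auto simp: norm_mult)
  have H': "integrable (lborel \<Otimes>\<^sub>M lborel) (case_prod ?H)" using H by simp
  have square: "(\<integral>z. ?H \<omega> z \<partial>lborel) = complex_of_real (?W \<omega> * (norm (fourier F \<omega>))\<^sup>2)" for \<omega>
  proof -
    let ?e = "\<lambda>y. cis (- (2 * pi * (\<omega> \<bullet> y))) * F y"
    have e: "integrable lborel ?e" by (rule integrable_fourier[OF F])
    have split: "cis (- (2 * pi * (\<omega> \<bullet> (y - y')))) = cis (- (2 * pi * (\<omega> \<bullet> y))) * cnj (cis (- (2 * pi * (\<omega> \<bullet> y'))))" for y y'
      by (simp add: cis_cnj cis_mult inner_diff_right algebra_simps)
    have "(\<integral>z. ?H \<omega> z \<partial>lborel) = (\<integral>z. complex_of_real (?W \<omega>) * (?e (fst z) * cnj (?e (snd z))) \<partial>lborel)"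
      by (rule Bochner_Integration.integral_cong[OF refl], simp only: split complex_cnj_mult, simp only: mult_ac)
    also have "\<dots> = complex_of_real (?W \<omega>) * (\<integral>z. (?e (fst z) * cnj (?e (snd z))) \<partial>lborel)"
      by simp
    also have "(\<integral>z. (?e (fst z) * cnj (?e (snd z))) \<partial>lborel) = (\<integral>y. (\<integral>y'. ?e y * cnj (?e y') \<partial>lborel) \<partial>lborel)"
    proof (subst lborel_pair.integral_fst)
      show "integrable (lborel \<Otimes>\<^sub>M lborel) (\<lambda>(x, y). ?e x * cnj (?e y))"
        by (rule integrable_tensor[OF sigma_finite_lborel sigma_finite_lborel e integrable_cnj[OF e]])
    qed (simp add: lborel_prod case_prod_beta')
    also have "\<dots> = fourier F \<omega> * cnj (fourier F \<omega>)"
      by (simp only: integral_mult_right_zero integral_mult_left_zero Bochner_Integration.integral_cnj fourier_def)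
    finally show ?thesis by (simp only: of_real_mult complex_norm_square)
  qed
  have rhs: "(\<integral>\<omega>. ?H \<omega> z \<partial>lborel) = complex_of_real (gaussian_kernel \<sigma> (fst z - snd z)) * ?K z" for z
    by (simp only: integral_mult_left_zero fourier_gaussian(2)[OF \<sigma>])
  have swap: "(\<integral>\<omega>. (\<integral>z. ?H \<omega> z \<partial>lborel) \<partial>lborel) = (\<integral>z. (\<integral>\<omega>. ?H \<omega> z \<partial>lborel) \<partial>lborel)"
    by (rule lborel_pair.Fubini_integral[OF H', symmetric])
  have int: "integrable lborel (\<lambda>\<omega>. complex_of_real (?W \<omega> * (norm (fourier F \<omega>))\<^sup>2))"
    using lborel_pair.integrable_fst[OF H'] by (simp only: square)
  have int': "integrable lborel (\<lambda>\<omega>. ?W \<omega> * (norm (fourier F \<omega>))\<^sup>2)"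
    using int by (simp only: complex_of_real_integrable_eq)
  have "(\<integral>\<^sup>+\<omega>. ennreal (?W \<omega> * (norm (fourier F \<omega>))\<^sup>2) \<partial>lborel) = ennreal (\<integral>\<omega>. ?W \<omega> * (norm (fourier F \<omega>))\<^sup>2 \<partial>lborel)"
    by (rule nn_integral_eq_integral[OF int']) simp
  also have "\<dots> = ennreal (norm (\<integral>\<omega>. complex_of_real (?W \<omega> * (norm (fourier F \<omega>))\<^sup>2) \<partial>lborel))"
    by (simp only: integral_complex_of_real norm_of_real) (simp add: abs_of_nonneg)
  also have "\<dots> = ennreal (norm (\<integral>z. complex_of_real (gaussian_kernel \<sigma> (fst z - snd z)) * ?K z \<partial>lborel))"
    using swap by (simp only: square rhs)
  also have "\<dots> \<le> (\<integral>\<^sup>+z. ennreal (norm (complex_of_real (gaussian_kernel \<sigma> (fst z - snd z)) * ?K z)) \<partial>lborel)"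
    using lborel_pair.integrable_snd[OF H'] by (intro integral_norm_bound_ennreal) (simp only: rhs)
  also have "\<dots> \<le> (\<integral>\<^sup>+z. ennreal ((norm (F (fst z)))\<^sup>2 / 2) * ennreal (gaussian_kernel \<sigma> (snd z - fst z))
      + ennreal ((norm (F (snd z)))\<^sup>2 / 2) * ennreal (gaussian_kernel \<sigma> (fst z - snd z)) \<partial>lborel)"
  proof (rule nn_integral_mono)
    fix z :: "'a \<times> 'a"
    let ?G = "gaussian_kernel \<sigma> (fst z - snd z)"
    have G: "gaussian_kernel \<sigma> (snd z - fst z) = ?G"
      using gaussian_kernel_minus[of \<sigma> "fst z - snd z"] by simp
    have "norm (F (fst z)) * norm (F (snd z)) \<le> (norm (F (fst z)))\<^sup>2 / 2 + (norm (F (snd z)))\<^sup>2 / 2"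
      using sum_squares_bound[of "norm (F (fst z))" "norm (F (snd z))"] by simp
    then have "?G * (norm (F (fst z)) * norm (F (snd z))) \<le> ?G * ((norm (F (fst z)))\<^sup>2 / 2 + (norm (F (snd z)))\<^sup>2 / 2)"
      by (rule mult_left_mono) simp
    then have "norm (complex_of_real ?G * ?K z) \<le> (norm (F (fst z)))\<^sup>2 / 2 * ?G + (norm (F (snd z)))\<^sup>2 / 2 * ?G"
      by (simp add: norm_mult algebra_simps)
    then show "ennreal (norm (complex_of_real ?G * ?K z))
        \<le> ennreal ((norm (F (fst z)))\<^sup>2 / 2) * ennreal (gaussian_kernel \<sigma> (snd z - fst z))
          + ennreal ((norm (F (snd z)))\<^sup>2 / 2) * ennreal ?G"
      by (simp add: G ennreal_mult[symmetric] ennreal_plus[symmetric] del: ennreal_plus)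
  qed
  also have "\<dots> = (\<integral>\<^sup>+z. ennreal ((norm (F (fst z)))\<^sup>2 / 2) * ennreal (gaussian_kernel \<sigma> (snd z - fst z)) \<partial>lborel)
      + (\<integral>\<^sup>+z. ennreal ((norm (F (snd z)))\<^sup>2 / 2) * ennreal (gaussian_kernel \<sigma> (fst z - snd z)) \<partial>lborel)"
    unfolding lborel_prod[symmetric] by (rule nn_integral_add) measurable
  also have "(\<integral>\<^sup>+z. ennreal ((norm (F (fst z)))\<^sup>2 / 2) * ennreal (gaussian_kernel \<sigma> (snd z - fst z)) \<partial>lborel)
      = (\<integral>\<^sup>+y. (\<integral>\<^sup>+y'. ennreal ((norm (F y))\<^sup>2 / 2) * ennreal (gaussian_kernel \<sigma> (y' - y)) \<partial>lborel) \<partial>lborel)"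
    unfolding lborel_prod[symmetric] by (subst lborel.nn_integral_fst[symmetric]) auto
  also have "(\<integral>\<^sup>+z. ennreal ((norm (F (snd z)))\<^sup>2 / 2) * ennreal (gaussian_kernel \<sigma> (fst z - snd z)) \<partial>lborel)
      = (\<integral>\<^sup>+y'. (\<integral>\<^sup>+y. ennreal ((norm (F y'))\<^sup>2 / 2) * ennreal (gaussian_kernel \<sigma> (y - y')) \<partial>lborel) \<partial>lborel)"
    unfolding lborel_prod[symmetric] by (subst lborel_pair.nn_integral_snd[symmetric]) auto
  also have "(\<integral>\<^sup>+y. (\<integral>\<^sup>+y'. ennreal ((norm (F y))\<^sup>2 / 2) * ennreal (gaussian_kernel \<sigma> (y' - y)) \<partial>lborel) \<partial>lborel)
      = (\<integral>\<^sup>+y. ennreal ((norm (F y))\<^sup>2 / 2) \<partial>lborel)"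
    by (intro nn_integral_cong) (simp add: nn_integral_cmult nn_integral_gaussian_kernel[OF \<sigma>])
  also have "\<dots> + \<dots> = (\<integral>\<^sup>+y. ennreal ((norm (F y))\<^sup>2 / 2) + ennreal ((norm (F y))\<^sup>2 / 2) \<partial>lborel)"
    by (rule nn_integral_add[symmetric]) measurable
  also have "\<dots> = (\<integral>\<^sup>+y. ennreal ((norm (F y))\<^sup>2) \<partial>lborel)"
    by (simp add: ennreal_plus[symmetric] del: ennreal_plus)
  finally show ?thesis .
qed

text \<open>Half of Plancherel's theorem, obtained by letting the Gaussian factor tend to one. The right hand side
  may be infinite, so an integrable \<open>F\<close> is enough.\<close>

lemma Plancherel_le:
  fixes F :: "'a::euclidean_space \<Rightarrow> complex"
  assumes F: "integrable lborel F"
  shows "(\<integral>\<^sup>+\<omega>. ennreal ((norm (fourier F \<omega>))\<^sup>2) \<partial>lborel) \<le> (\<integral>\<^sup>+y. ennreal ((norm (F y))\<^sup>2) \<partial>lborel)"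
proof (rule nn_integral_Fatou_bound)
  note [measurable] = borel_measurable_integrable[OF F, simplified]
  let ?u = "\<lambda>n \<omega>::'a. exp (- (inverse (real (Suc n)) * norm \<omega>)\<^sup>2 / 2) * (norm (fourier F \<omega>))\<^sup>2"
  show "?u n \<in> borel_measurable lborel" for n
    unfolding fourier_def by measurable
  show "(\<lambda>n. ?u n \<omega>) \<longlonglongrightarrow> (norm (fourier F \<omega>))\<^sup>2" for \<omega>
  proof -
    have "(\<lambda>n. ?u n \<omega>) \<longlonglongrightarrow> exp (- (0 * norm \<omega>)\<^sup>2 / 2) * (norm (fourier F \<omega>))\<^sup>2"
      by (intro tendsto_intros LIMSEQ_inverse_real_of_nat) auto
    then show ?thesis by simp
  qed
  show "(\<integral>\<^sup>+\<omega>. ennreal (?u n \<omega>) \<partial>lborel) \<le> (\<integral>\<^sup>+y. ennreal ((norm (F y))\<^sup>2) \<partial>lborel)" for n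
    by (rule gaussian_Plancherel_le[OF F]) simp
qed simp

section \<open>The bilinear form and its two endpoint estimates\<close>

text \<open>The two linear maps in the arguments of \<open>f\<close> and \<open>g\<close>. The relation \<open>P - Q = I\<close> expresses the variable of
  integration as the difference of these arguments; it makes \<open>(x, y) \<mapsto> (x + P y, x + Q y)\<close> preserve
  volume.\<close>

locale wigner_pair =
  fixes P Q :: "real^'n^'n"
  assumes invertible_P: "invertible P" and invertible_Q: "invertible Q"
    and P_eq: "P = Q + mat 1"
begin

definition slice :: "(real^'n \<Rightarrow> complex) \<Rightarrow> (real^'n \<Rightarrow> complex) \<Rightarrow> real^'n \<Rightarrow> real^'n \<Rightarrow> complex" where
  "slice f g x y = f (x + P *v y) * cnj (g (x + Q *v y))"

definition wigner :: "(real^'n \<Rightarrow> complex) \<Rightarrow> (real^'n \<Rightarrow> complex) \<Rightarrow> (real^'n) \<times> (real^'n) \<Rightarrow> complex" where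
  "wigner f g X = fourier (slice f g (fst X)) (snd X)"

lemma P_minus_Q: "P *v y - Q *v y = y"
  by (simp add: P_eq matrix_vector_mult_add_rdistrib)

text \<open>The densities \<open>u\<close> and \<open>v\<close> stand for \<open>\<bar>f\<bar> powr (1/s)\<close> and \<open>\<bar>g\<bar> powr (1/(1-s))\<close>. Keeping them separate from \<open>f\<close> and
  \<open>g\<close> covers the endpoints: for \<open>s = 0\<close> the hypothesis on \<open>f\<close> says that \<open>\<bar>f\<bar> \<le> 1\<close> where \<open>u \<noteq> 0\<close> and
  \<open>f = 0\<close> elsewhere.\<close>

lemma slice_Hoelder:
  assumes [measurable]: "f \<in> borel_measurable borel" "g \<in> borel_measurable borel"
    and u: "integrable lborel u" "\<And>x. 0 \<le> u x" and v: "integrable lborel v" "\<And>x. 0 \<le> v x"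
    and s: "0 \<le> s" "s \<le> 1"
    and f: "\<And>x. norm (f x) \<le> u x powr s" and g: "\<And>x. norm (g x) \<le> v x powr (1 - s)"
  shows "integrable lborel (slice f g x)"
    and "(\<integral>y. norm (slice f g x y) \<partial>lborel)
       \<le> (\<integral>x. u x \<partial>lborel) powr s * (\<integral>x. v x \<partial>lborel) powr (1 - s) / (\<bar>det P\<bar> powr s * \<bar>det Q\<bar> powr (1 - s))"
proof -
  note [measurable] = borel_measurable_integrable[OF u(1), simplified] borel_measurable_integrable[OF v(1), simplified]
  have uP: "integrable lborel (\<lambda>y. u (x + P *v y))" "(\<integral>y. u (x + P *v y) \<partial>lborel) = (\<integral>y. u y \<partial>lborel) / \<bar>det P\<bar>"
    using integral_affine[OF invertible_P, of u x] u(1) by (auto simp: divide_inverse mult.commute)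
  have vQ: "integrable lborel (\<lambda>y. v (x + Q *v y))" "(\<integral>y. v (x + Q *v y) \<partial>lborel) = (\<integral>y. v y \<partial>lborel) / \<bar>det Q\<bar>"
    using integral_affine[OF invertible_Q, of v x] v(1) by (auto simp: divide_inverse mult.commute)
  note H = weighted_Hoelder[OF uP(1) vQ(1) u(2) v(2) s]
  have le: "norm (slice f g x y) \<le> u (x + P *v y) powr s * v (x + Q *v y) powr (1 - s)" for y
    unfolding slice_def norm_mult complex_mod_cnj by (intro mult_mono f g) auto
  have [measurable]: "slice f g x \<in> borel_measurable borel"
    unfolding slice_def by measurable
  show int: "integrable lborel (slice f g x)"
    by (rule Bochner_Integration.integrable_bound[OF H(1)]) (auto intro!: AE_I2 order_trans[OF le])
  have "(\<integral>y. norm (slice f g x y) \<partial>lborel) \<le> (\<integral>y. u (x + P *v y) powr s * v (x + Q *v y) powr (1 - s) \<partial>lborel)"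
    by (intro integral_mono integrable_norm int H(1) le)
  also have "\<dots> \<le> (\<integral>y. u (x + P *v y) \<partial>lborel) powr s * (\<integral>y. v (x + Q *v y) \<partial>lborel) powr (1 - s)"
    by (rule H(2))
  also have "\<dots> = (\<integral>x. u x \<partial>lborel) powr s * (\<integral>x. v x \<partial>lborel) powr (1 - s) / (\<bar>det P\<bar> powr s * \<bar>det Q\<bar> powr (1 - s))"
    unfolding uP(2) vQ(2) using u v by (simp add: powr_divide)
  finally show "(\<integral>y. norm (slice f g x y) \<partial>lborel)
       \<le> (\<integral>x. u x \<partial>lborel) powr s * (\<integral>x. v x \<partial>lborel) powr (1 - s) / (\<bar>det P\<bar> powr s * \<bar>det Q\<bar> powr (1 - s))" .
qed

lemma norm_wigner_le: "norm (wigner f g X) \<le> (\<integral>y. norm (slice f g (fst X) y) \<partial>lborel)"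
proof -
  have "norm (wigner f g X) \<le> (\<integral>y. norm (cis (- (2 * pi * (snd X \<bullet> y))) * slice f g (fst X) y) \<partial>lborel)"
    unfolding wigner_def fourier_def by (rule integral_norm_bound)
  then show ?thesis by (simp add: norm_mult)
qed

lemma borel_measurable_wigner[measurable]:
  assumes [measurable]: "f \<in> borel_measurable borel" "g \<in> borel_measurable borel"
  shows "wigner f g \<in> borel_measurable borel"
proof -
  have "wigner f g \<in> borel_measurable (lborel \<Otimes>\<^sub>M lborel)"
    unfolding wigner_def[abs_def] fourier_def slice_def by measurable
  then show ?thesis by (simp add: lborel_prod)
qed

text \<open>Plancherel's inequality for each slice, then Tonelli's theorem: for fixed \<open>y\<close>, translating \<open>x\<close> by
  \<open>P y\<close> turns \<open>\<bar>f (x + P y)\<bar>\<^sup>2 \<bar>g (x + Q y)\<bar>\<^sup>2\<close> into \<open>\<bar>f x\<bar>\<^sup>2 \<bar>g (x - y)\<bar>\<^sup>2\<close>, and integrating in \<open>y\<close> separates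
  the two factors.\<close>

lemma wigner_L2_le:
  assumes [measurable]: "f \<in> borel_measurable borel" "g \<in> borel_measurable borel"
    and f: "integrable lborel (\<lambda>x. (norm (f x))\<^sup>2)" and g: "integrable lborel (\<lambda>x. (norm (g x))\<^sup>2)"
  shows "(\<integral>\<^sup>+X. ennreal ((norm (wigner f g X))\<^sup>2) \<partial>lborel)
    \<le> ennreal ((\<integral>x. (norm (f x))\<^sup>2 \<partial>lborel) * (\<integral>x. (norm (g x))\<^sup>2 \<partial>lborel))"
proof -
  have half: "norm (h x) \<le> (norm (h x))\<^sup>2 powr (1 / 2)" for h :: "real^'n \<Rightarrow> complex" and x
    by (simp add: powr_half_sqrt)
  have int: "integrable lborel (slice f g x)" for x
    by (rule slice_Hoelder(1)[OF _ _ f _ g _, where s="1/2"]) (use half in auto)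
  let ?f = "\<lambda>x. ennreal ((norm (f x))\<^sup>2)" and ?g = "\<lambda>x. ennreal ((norm (g x))\<^sup>2)"
  have [measurable]: "wigner f g \<in> borel_measurable (lborel \<Otimes>\<^sub>M lborel)"
    by (simp add: lborel_prod)
  have "(\<integral>\<^sup>+X. ennreal ((norm (wigner f g X))\<^sup>2) \<partial>lborel)
      = (\<integral>\<^sup>+x. (\<integral>\<^sup>+\<omega>. ennreal ((norm (wigner f g (x, \<omega>)))\<^sup>2) \<partial>lborel) \<partial>lborel)"
    unfolding lborel_prod[symmetric] by (subst lborel.nn_integral_fst) auto
  also have "\<dots> \<le> (\<integral>\<^sup>+x. (\<integral>\<^sup>+y. ennreal ((norm (slice f g x y))\<^sup>2) \<partial>lborel) \<partial>lborel)"
    unfolding wigner_def by (rule nn_integral_mono) (simp only: fst_conv snd_conv Plancherel_le[OF int])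
  also have "\<dots> = (\<integral>\<^sup>+x. (\<integral>\<^sup>+y. ?f (x + P *v y) * ?g (x + Q *v y) \<partial>lborel) \<partial>lborel)"
    by (simp add: slice_def norm_mult power_mult_distrib ennreal_mult)
  also have "\<dots> = (\<integral>\<^sup>+y. (\<integral>\<^sup>+x. ?f (x + P *v y) * ?g (x + Q *v y) \<partial>lborel) \<partial>lborel)"
    by (rule lborel_pair.Fubini') measurable
  also have "\<dots> = (\<integral>\<^sup>+y. (\<integral>\<^sup>+x. ?f x * ?g (x - y) \<partial>lborel) \<partial>lborel)"
  proof (rule nn_integral_cong)
    fix y :: "real^'n"
    have Q: "P *v y + x - y = x + Q *v y" "x + P *v y - y = x + Q *v y" for x
      using P_minus_Q[of y] by (simp_all add: algebra_simps)
    show "(\<integral>\<^sup>+x. ?f (x + P *v y) * ?g (x + Q *v y) \<partial>lborel) = (\<integral>\<^sup>+x. ?f x * ?g (x - y) \<partial>lborel)"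
      by (subst nn_integral_lborel_translate[of "\<lambda>x. ?f x * ?g (x - y)" "P *v y", symmetric])
         (simp_all add: Q add.commute)
  qed
  also have "\<dots> = (\<integral>\<^sup>+x. (\<integral>\<^sup>+y. ?f x * ?g (x - y) \<partial>lborel) \<partial>lborel)"
    by (rule lborel_pair.Fubini') measurable
  also have "\<dots> = (\<integral>\<^sup>+x. ?f x * (\<integral>\<^sup>+y. ?g y \<partial>lborel) \<partial>lborel)"
  proof (rule nn_integral_cong)
    fix x :: "real^'n"
    have "(\<integral>\<^sup>+y. ?g y \<partial>lborel) = (\<integral>\<^sup>+y. ?g (x - y) \<partial>lborel)"
      by (subst lborel_affine[of "-1" x]) (simp_all add: nn_integral_density nn_integral_distr)
    then show "(\<integral>\<^sup>+y. ?f x * ?g (x - y) \<partial>lborel) = ?f x * (\<integral>\<^sup>+y. ?g y \<partial>lborel)"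
      by (simp add: nn_integral_cmult)
  qed
  also have "\<dots> = (\<integral>\<^sup>+x. ?f x \<partial>lborel) * (\<integral>\<^sup>+y. ?g y \<partial>lborel)"
    by (rule nn_integral_multc) measurable
  also have "\<dots> = ennreal ((\<integral>x. (norm (f x))\<^sup>2 \<partial>lborel) * (\<integral>x. (norm (g x))\<^sup>2 \<partial>lborel))"
    using f g by (simp add: nn_integral_eq_integral ennreal_mult)
  finally show ?thesis .
qed

end

section \<open>The three lines theorem\<close>

text \<open>Dividing \<open>F\<close> by the exponential that interpolates between the bounds reduces the claim to bounds equal
  to one on both edges. Since \<open>F\<close> is bounded, the factor \<open>exp (\<epsilon> (z\<^sup>2 - 1))\<close> makes the quotient small at
  both ends of the strip and does not exceed one in modulus on it, so the maximum modulus principle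
  applies on a large rectangle; then \<open>\<epsilon> \<rightarrow> 0\<close>.\<close>

lemma Hadamard_three_lines:
  fixes F :: "complex \<Rightarrow> complex"
  assumes holo: "F holomorphic_on {z. 0 < Re z \<and> Re z < 1}"
    and cont: "continuous_on {z. 0 \<le> Re z \<and> Re z \<le> 1} F"
    and C: "\<And>z. 0 \<le> Re z \<Longrightarrow> Re z \<le> 1 \<Longrightarrow> norm (F z) \<le> C"
    and M: "0 < M0" "0 < M1"
    and left: "\<And>z. Re z = 0 \<Longrightarrow> norm (F z) \<le> M0" and right: "\<And>z. Re z = 1 \<Longrightarrow> norm (F z) \<le> M1"
    and z: "0 \<le> Re z" "Re z \<le> 1"
  shows "norm (F z) \<le> M0 powr (1 - Re z) * M1 powr Re z"
proof -
  define w where "w = (\<lambda>x. (1 - x) * ln M0 + x * ln M1)"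
  define h where "h = (\<lambda>z. (1 - z) * complex_of_real (ln M0) + z * complex_of_real (ln M1))"
  have Re_h: "Re (h z) = w (Re z)" for z by (simp add: h_def w_def)
  define G where "G = (\<lambda>\<epsilon> z. F z * exp (- h z) * exp (complex_of_real \<epsilon> * (z\<^sup>2 - 1)))"
  have normG: "norm (G \<epsilon> z) = norm (F z) * exp (- w (Re z)) * exp (\<epsilon> * ((Re z)\<^sup>2 - (Im z)\<^sup>2 - 1))" for \<epsilon> z
    by (simp add: G_def norm_mult Re_h power2_eq_square)
  have C0: "C \<ge> 0" using C[of 0] norm_ge_zero[of "F 0"] by (simp del: norm_ge_zero)
  define K where "K = exp (\<bar>ln M0\<bar> + \<bar>ln M1\<bar>)"
  have wK: "exp (- w x) \<le> K" if "0 \<le> x" "x \<le> 1" for x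
  proof -
    have "\<bar>(1 - x) * ln M0\<bar> \<le> \<bar>ln M0\<bar>" "\<bar>x * ln M1\<bar> \<le> \<bar>ln M1\<bar>"
      using that by (auto simp: abs_mult mult_left_le_one_le)
    then show ?thesis unfolding w_def K_def by (subst exp_le_cancel_iff) linarith
  qed
  have le1: "norm (G \<epsilon> z) \<le> 1" if \<epsilon>: "\<epsilon> > 0" for \<epsilon>
  proof -
    \<comment> \<open>High enough to contain \<open>z\<close>, and for the damping factor to outweigh the bound \<open>C * K\<close> on the horizontal
      sides.\<close>
    define R where "R = max 1 (max (\<bar>Im z\<bar>) (C * K / \<epsilon>))"
    have R: "R \<ge> 1" "\<bar>Im z\<bar> \<le> R" "C * K / \<epsilon> \<le> R"
      by (simp_all add: R_def)
    then have CK: "C * K \<le> \<epsilon> * R" using \<epsilon> by (simp add: divide_le_eq mult.commute)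
    define S where "S = cbox (Complex 0 (- R)) (Complex 1 R)"
    have S: "x \<in> S \<longleftrightarrow> 0 \<le> Re x \<and> Re x \<le> 1 \<and> \<bar>Im x\<bar> \<le> R" for x
      by (auto simp: S_def in_cbox_complex_iff)
    have iS: "interior S = box (Complex 0 (- R)) (Complex 1 R)" by (simp add: S_def)
    show ?thesis
    proof (rule maximum_modulus_frontier[of "G \<epsilon>" S])
      have "interior S \<subseteq> {z. 0 < Re z \<and> Re z < 1}" by (auto simp: iS in_box_complex_iff)
      then show "G \<epsilon> holomorphic_on interior S"
        unfolding G_def h_def by (intro holomorphic_intros holomorphic_on_subset[OF holo])
      have "closure S \<subseteq> {z. 0 \<le> Re z \<and> Re z \<le> 1}"
        by (auto simp: S_def in_cbox_complex_iff)
      then show "continuous_on (closure S) (G \<epsilon>)"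
        unfolding G_def h_def by (intro continuous_intros continuous_on_subset[OF cont])
      show "bounded S" by (simp add: S_def)
      show "z \<in> S" using z R by (simp add: S)
      fix x assume "x \<in> frontier S"
      then have x: "0 \<le> Re x" "Re x \<le> 1" "\<bar>Im x\<bar> \<le> R" and "x \<notin> interior S"
        by (auto simp: frontier_def S_def in_cbox_complex_iff)
      have "(Re x)\<^sup>2 \<le> 1" using x by (simp add: power_le_one)
      moreover have "0 \<le> (Im x)\<^sup>2" by simp
      ultimately have "(Re x)\<^sup>2 - (Im x)\<^sup>2 - 1 \<le> 0" by linarith
      then have damp: "exp (\<epsilon> * ((Re x)\<^sup>2 - (Im x)\<^sup>2 - 1)) \<le> 1"
        using \<epsilon> by (simp add: mult_nonneg_nonpos)
      from x \<open>x \<notin> interior S\<close> consider "Re x = 0" | "Re x = 1" | "\<bar>Im x\<bar> = R"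
        by (force simp: iS in_box_complex_iff)
      then show "norm (G \<epsilon> x) \<le> 1"
      proof cases
        case 1
        then have "norm (F x) * exp (- w (Re x)) \<le> 1"
          using left[OF 1] M by (simp add: w_def exp_minus field_simps)
        then show ?thesis unfolding normG by (rule mult_le_one[OF _ exp_ge_zero damp])
      next
        case 2
        then have "norm (F x) * exp (- w (Re x)) \<le> 1"
          using right[OF 2] M by (simp add: w_def exp_minus field_simps)
        then show ?thesis unfolding normG by (rule mult_le_one[OF _ exp_ge_zero damp])
      next
        case 3
        have Im: "(Im x)\<^sup>2 = R\<^sup>2" using 3 by (metis power2_abs)
        have "(Re x)\<^sup>2 \<le> 1" using x by (simp add: power_le_one)
        then have "\<epsilon> * ((Re x)\<^sup>2 - (Im x)\<^sup>2 - 1) \<le> - (\<epsilon> * R\<^sup>2)"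
          using \<epsilon> by (simp add: Im algebra_simps)
        then have e: "exp (\<epsilon> * ((Re x)\<^sup>2 - (Im x)\<^sup>2 - 1)) \<le> exp (- (\<epsilon> * R\<^sup>2))" by simp
        have "\<epsilon> * R \<le> \<epsilon> * R\<^sup>2" using R \<epsilon> by (simp add: power2_eq_square)
        also have "\<dots> \<le> exp (\<epsilon> * R\<^sup>2)" using exp_ge_add_one_self[of "\<epsilon> * R\<^sup>2"] by linarith
        finally have "C * K \<le> exp (\<epsilon> * R\<^sup>2)" using CK by linarith
        then have "C * K * exp (- (\<epsilon> * R\<^sup>2)) \<le> 1" by (simp add: exp_minus field_simps)
        moreover have "norm (F x) * exp (- w (Re x)) * exp (\<epsilon> * ((Re x)\<^sup>2 - (Im x)\<^sup>2 - 1)) \<le> C * K * exp (- (\<epsilon> * R\<^sup>2))"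
          using C0 by (intro mult_mono C wK x e) (auto simp: K_def)
        ultimately show ?thesis unfolding normG by linarith
      qed
    qed
  qed
  have "norm (F z) * exp (- w (Re z)) \<le> 1"
  proof (rule LIMSEQ_le_const2)
    let ?c = "(Re z)\<^sup>2 - (Im z)\<^sup>2 - 1"
    have "(\<lambda>n. norm (F z) * exp (- w (Re z)) * exp (inverse (real (Suc n)) * ?c))
        \<longlonglongrightarrow> norm (F z) * exp (- w (Re z)) * exp (0 * ?c)"
      by (intro tendsto_intros LIMSEQ_inverse_real_of_nat)
    then show "(\<lambda>n. norm (G (inverse (real (Suc n))) z)) \<longlonglongrightarrow> norm (F z) * exp (- w (Re z))"
      by (simp add: normG)
    show "\<exists>N. \<forall>n\<ge>N. norm (G (inverse (real (Suc n))) z) \<le> 1"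
      using le1 by simp
  qed
  then have "norm (F z) \<le> exp (w (Re z))"
    by (simp add: exp_minus field_simps)
  also have "\<dots> = M0 powr (1 - Re z) * M1 powr Re z"
    using M by (simp add: w_def powr_def exp_add)
  finally show ?thesis .
qed

section \<open>Interpolation for simple functions\<close>

lemma fourier_sum:
  assumes "\<And>i. i \<in> I \<Longrightarrow> integrable lborel (G i)"
  shows "fourier (\<lambda>y. \<Sum>i\<in>I. c i * G i y) \<omega> = (\<Sum>i\<in>I. c i * fourier (G i) \<omega>)"
proof -
  have "fourier (\<lambda>y. \<Sum>i\<in>I. c i * G i y) \<omega> = (\<integral>y. (\<Sum>i\<in>I. c i * (cis (- (2 * pi * (\<omega> \<bullet> y))) * G i y)) \<partial>lborel)"
    unfolding fourier_def by (simp only: sum_distrib_left mult.left_commute)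
  also have "\<dots> = (\<Sum>i\<in>I. (\<integral>y. c i * (cis (- (2 * pi * (\<omega> \<bullet> y))) * G i y) \<partial>lborel))"
    by (intro Bochner_Integration.integral_sum integrable_mult_right integrable_fourier assms)
  finally show ?thesis by (simp only: fourier_def integral_mult_right_zero)
qed

text \<open>The analytic family through the value \<open>v\<close>: it keeps the phase of \<open>v\<close> and replaces the modulus by
  \<open>\<bar>v\<bar>\<close> raised to the affine exponent \<open>c + d z\<close>. The value \<open>0\<close> at \<open>v = 0\<close> keeps the composition with a
  function supported where that function is.\<close>

definition cpow :: "real \<Rightarrow> real \<Rightarrow> complex \<Rightarrow> complex \<Rightarrow> complex" where
  "cpow c d v z = (if v = 0 then 0 else sgn v * exp (of_real (ln (norm v)) * (of_real c + of_real d * z)))"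

lemma cpow_0[simp]: "cpow c d 0 z = 0"
  by (simp add: cpow_def)

lemma norm_cpow: "norm (cpow c d v z) = norm v powr (c + d * Re z)"
  by (simp add: cpow_def norm_mult norm_sgn powr_def mult.commute)

text \<open>The bilinear form is conjugate linear in its second argument. Evaluating the family for \<open>g\<close> at
  \<open>cnj z\<close> compensates for this: the conjugated factor is again holomorphic in \<open>z\<close>.\<close>

lemma cnj_cpow: "cnj (cpow c d v (cnj z)) = cpow c d (cnj v) z"
  by (simp add: cpow_def exp_cnj sgn_eq)

lemma cpow_eq:
  assumes "c + d * t = 1"
  shows "cpow c d v (of_real t) = v"
proof (cases "v = 0")
  case False
  have "complex_of_real c + of_real d * of_real t = of_real (c + d * t)" by simp
  moreover have "exp (complex_of_real (ln (norm v))) = complex_of_real (norm v)"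
    using False exp_of_real[of "ln (norm v)"] by simp
  ultimately show ?thesis
    using False assms unfolding cpow_def by (simp add: sgn_eq)
qed simp

lemma cpow_holomorphic: "(\<lambda>z. cpow c d v z) holomorphic_on S"
  by (cases "v = 0") (auto simp: cpow_def intro!: holomorphic_intros)

lemma norm_cpow_le_strip:
  assumes "0 \<le> Re z" "Re z \<le> 1"
  shows "norm (cpow c d v z) \<le> exp (\<bar>ln (norm v)\<bar> * (\<bar>c\<bar> + \<bar>d\<bar>))"
proof (cases "v = 0")
  case False
  have "\<bar>c + d * Re z\<bar> \<le> \<bar>c\<bar> + \<bar>d\<bar>"
  proof -
    have "\<bar>d * Re z\<bar> \<le> \<bar>d\<bar>" using assms by (simp add: abs_mult mult_left_le)
    then show ?thesis by linarith
  qed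
  then have "\<bar>ln (norm v) * (c + d * Re z)\<bar> \<le> \<bar>ln (norm v)\<bar> * (\<bar>c\<bar> + \<bar>d\<bar>)"
    unfolding abs_mult by (rule mult_left_mono) simp
  then show ?thesis using False by (simp add: norm_cpow powr_def mult.commute)
qed simp

lemma simple_function_level_sum:
  fixes f :: "'a \<Rightarrow> complex" and \<phi> :: "complex \<Rightarrow> complex"
  assumes "finite (range f)" "\<phi> 0 = 0"
  shows "\<phi> (f x) = (\<Sum>u\<in>range f - {0}. \<phi> u * indicator (f -` {u}) x)"
proof -
  have "(\<Sum>u\<in>range f - {0}. \<phi> u * indicator (f -` {u}) x) = (\<Sum>u\<in>range f - {0}. if u = f x then \<phi> (f x) else 0)"
    by (intro sum.cong) (auto simp: indicator_def)
  also have "\<dots> = \<phi> (f x)" using assms by (auto simp: sum.delta')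
  finally show ?thesis ..
qed

lemma integrable_level_indicator:
  fixes f :: "'a \<Rightarrow> complex"
  assumes [measurable]: "f \<in> borel_measurable N" and int: "integrable N (\<lambda>x. norm (f x) powr r)" and u: "u \<noteq> 0"
    and sp: "space N = UNIV"
  shows "integrable N (indicator (f -` {u}) :: 'a \<Rightarrow> 'b::{banach,real_normed_algebra_1,second_countable_topology})"
proof (rule Bochner_Integration.integrable_bound)
  have [measurable]: "f -` {u} \<in> sets N"
    using measurable_sets[of f N borel "{u}"] sp by simp
  show "(indicator (f -` {u}) :: 'a \<Rightarrow> 'b) \<in> borel_measurable N" by measurable
  show "integrable N (\<lambda>x. norm u powr (- r) * norm (f x) powr r)" using int by simp
  show "AE x in N. norm (indicator (f -` {u}) x :: 'b) \<le> norm (norm u powr (- r) * norm (f x) powr r)"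
    using u by (auto simp: indicator_def powr_minus)
qed

context wigner_pair
begin

lemma wigner_sum:
  assumes "\<And>i j. i \<in> I \<Longrightarrow> j \<in> J \<Longrightarrow> integrable lborel (slice (F i) (G j) (fst X))"
  shows "wigner (\<lambda>x. \<Sum>i\<in>I. c i * F i x) (\<lambda>x. \<Sum>j\<in>J. d j * G j x) X
    = (\<Sum>(i,j)\<in>I \<times> J. (c i * cnj (d j)) * wigner (F i) (G j) X)"
proof -
  have "slice (\<lambda>x. \<Sum>i\<in>I. c i * F i x) (\<lambda>x. \<Sum>j\<in>J. d j * G j x) (fst X)
     = (\<lambda>y. \<Sum>p\<in>I \<times> J. (c (fst p) * cnj (d (snd p))) * slice (F (fst p)) (G (snd p)) (fst X) y)"
    by (rule ext) (simp add: slice_def sum_product sum.cartesian_product case_prod_beta' mult_ac)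
  then have "wigner (\<lambda>x. \<Sum>i\<in>I. c i * F i x) (\<lambda>x. \<Sum>j\<in>J. d j * G j x) X
     = (\<Sum>p\<in>I \<times> J. (c (fst p) * cnj (d (snd p))) * fourier (slice (F (fst p)) (G (snd p)) (fst X)) (snd X))"
    unfolding wigner_def by (simp only:) (rule fourier_sum, use assms in auto)
  then show ?thesis by (simp add: wigner_def case_prod_beta')
qed

text \<open>Bilinear Riesz-Thorin interpolation, tested against a third simple function \<open>h\<close>. With \<open>a = 1/p\<close> and
  \<open>b = 1/q\<close>, the point \<open>(a, b)\<close> lies on the segment from \<open>(a0, 0)\<close> on the base of the triangle to the apex
  \<open>(1/2, 1/2)\<close>, at the parameter \<open>2 b\<close>. The families replacing \<open>f\<close>, \<open>g\<close> and \<open>h\<close> have exponents that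
  are affine in \<open>z\<close> and move along this segment: on \<open>Re z = 0\<close> the moduli fit the boundedness
  estimate, on \<open>Re z = 1\<close> all three are square integrable, and at \<open>z = 2 b\<close> they are the given functions.

  The integrals are only bounded by arbitrary positive numbers \<open>Fa\<close>, \<open>Ga\<close> and \<open>Ha\<close>, so that the edge
  bounds in the three lines theorem are positive even when a function vanishes.\<close>

lemma wigner_interpolation_simple:
  fixes f g :: "real^'n \<Rightarrow> complex" and h :: "(real^'n) \<times> (real^'n) \<Rightarrow> complex"
  assumes f: "simple_function lborel f" and g: "simple_function lborel g" and h: "simple_function lborel h"
    and a: "0 < a" "a < 1" and b: "0 < b" "b \<le> 1 / 2" "b \<le> a" "a \<le> 1 - b"
    and int_f: "integrable lborel (\<lambda>x. norm (f x) powr (1 / a))"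
    and int_g: "integrable lborel (\<lambda>x. norm (g x) powr (1 / (1 - a)))"
    and int_h: "integrable lborel (\<lambda>x. norm (h x) powr (1 / (1 - b)))"
    and Fa: "0 < Fa" "(\<integral>x. norm (f x) powr (1 / a) \<partial>lborel) \<le> Fa"
    and Ga: "0 < Ga" "(\<integral>x. norm (g x) powr (1 / (1 - a)) \<partial>lborel) \<le> Ga"
    and Ha: "0 < Ha" "(\<integral>x. norm (h x) powr (1 / (1 - b)) \<partial>lborel) \<le> Ha"
  shows "norm (\<integral>X. wigner f g X * h X \<partial>lborel)
    \<le> Fa powr a * Ga powr (1 - a) * Ha powr (1 - b) / (\<bar>det P\<bar> powr (a - b) * \<bar>det Q\<bar> powr (1 - a - b))"
proof -
  have detP: "\<bar>det P\<bar> > 0" and detQ: "\<bar>det Q\<bar> > 0"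
    using invertible_P invertible_Q by (auto simp: invertible_det_nz)
  note [measurable] = borel_measurable_simple_function[OF f, simplified]
    borel_measurable_simple_function[OF g, simplified] borel_measurable_simple_function[OF h, simplified]
  have fin: "finite (range f)" "finite (range g)" "finite (range h)"
    using simple_functionD(1)[OF f] simple_functionD(1)[OF g] simple_functionD(1)[OF h] by simp_all
  \<comment> \<open>At the apex every point of the base may serve as the other end of the segment, so \<open>a0\<close> is chosen
    arbitrarily there.\<close>
  define a0 where "a0 = (if b = 1 / 2 then 1 / 2 else (a - b) / (1 - 2 * b))"
  have a0: "0 \<le> a0" "a0 \<le> 1" "(1 - 2 * b) * a0 = a - b"
    using a b by (auto simp: a0_def field_simps)
  define \<phi> where "\<phi> = cpow (a0 / a) ((1 / 2 - a0) / a)"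
  define \<psi> where "\<psi> = cpow ((1 - a0) / (1 - a)) ((a0 - 1 / 2) / (1 - a))"
  define \<eta> where "\<eta> = cpow (1 / (1 - b)) ((- 1 / 2) / (1 - b))"
  let ?\<theta> = "complex_of_real (2 * b)"
  have \<theta>: "\<phi> v ?\<theta> = v" "\<psi> v ?\<theta> = v" "\<eta> v ?\<theta> = v" for v
  proof -
    have affine: "c / x + d / x * t = (c + d * t) / x" for c d t x :: real
      by (simp add: add_divide_distrib)
    have "a0 + (1 / 2 - a0) * (2 * b) = a" using a0(3) by (simp add: algebra_simps)
    then have "a0 / a + (1 / 2 - a0) / a * (2 * b) = 1"
      using a by (simp add: add_divide_distrib[symmetric])
    then show "\<phi> v ?\<theta> = v" unfolding \<phi>_def by (rule cpow_eq)
    have "(1 - a0) + (a0 - 1 / 2) * (2 * b) = 1 - a" using a0(3) by (simp add: algebra_simps)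
    then have "(1 - a0) / (1 - a) + (a0 - 1 / 2) / (1 - a) * (2 * b) = 1"
      using a by (simp add: add_divide_distrib[symmetric])
    then show "\<psi> v ?\<theta> = v" unfolding \<psi>_def by (rule cpow_eq)
    have "1 + (- 1 / 2) * (2 * b) = 1 - b" by simp
    then have "1 / (1 - b) + (- 1 / 2) / (1 - b) * (2 * b) = 1"
      unfolding affine using b by simp
    then show "\<eta> v ?\<theta> = v" unfolding \<eta>_def by (rule cpow_eq)
  qed
  let ?U = "range f - {0}" and ?V = "range g - {0}" and ?W = "range h - {0}"
  let ?T = "(?U \<times> ?V) \<times> ?W"
  let ?ind = "\<lambda>f u. indicator (f -` {u}) :: _ \<Rightarrow> complex"
  \<comment> \<open>The pairing evaluated at indicator functions of level sets. Expanding in these makes the \<open>z\<close>-dependence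
    of \<open>F\<close> a finite exponential sum, so that \<open>F\<close> is entire.\<close>
  define K where "K = (\<lambda>((u, v), w). \<integral>X. wigner (?ind f u) (?ind g v) X * ?ind h w X \<partial>lborel)"
  define F where "F = (\<lambda>z. \<Sum>((u, v), w)\<in>?T. \<phi> u z * \<psi> (cnj v) z * \<eta> w z * K ((u, v), w))"
  define f' where "f' = (\<lambda>z x. \<phi> (f x) z)"
  define g' where "g' = (\<lambda>z x. \<psi> (g x) (cnj z))"
  define h' where "h' = (\<lambda>z X. \<eta> (h X) z)"
  have meas_level[measurable]: "f -` {u} \<in> sets borel" "g -` {u} \<in> sets borel" "h -` {w} \<in> sets borel" for u w
    using measurable_sets_borel[of f borel "{u}"] measurable_sets_borel[of g borel "{u}"] measurable_sets_borel[of h borel "{w}"]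
    by auto
  have f'_sum: "f' z x = (\<Sum>u\<in>?U. \<phi> u z * ?ind f u x)" for z x
    unfolding f'_def by (rule simple_function_level_sum) (simp_all add: fin \<phi>_def)
  have g'_sum: "g' z x = (\<Sum>v\<in>?V. \<psi> v (cnj z) * ?ind g v x)" for z x
    unfolding g'_def by (rule simple_function_level_sum) (simp_all add: fin \<psi>_def)
  have h'_sum: "h' z X = (\<Sum>w\<in>?W. \<eta> w z * ?ind h w X)" for z X
    unfolding h'_def by (rule simple_function_level_sum) (simp_all add: fin \<eta>_def)
  have [measurable]: "f' z \<in> borel_measurable borel" "g' z \<in> borel_measurable borel" "h' z \<in> borel_measurable borel" for z
    unfolding f'_sum[abs_def] g'_sum[abs_def] h'_sum[abs_def] by measurable
  have ind_f: "integrable lborel (indicator (f -` {u}) :: _ \<Rightarrow> real)" if "u \<noteq> 0" for u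
    by (rule integrable_level_indicator[OF _ int_f that]) simp_all
  have ind_g: "integrable lborel (indicator (g -` {v}) :: _ \<Rightarrow> real)" if "v \<noteq> 0" for v
    by (rule integrable_level_indicator[OF _ int_g that]) simp_all
  have ind_h: "integrable lborel (?ind h w)" if "w \<noteq> 0" for w
    by (rule integrable_level_indicator[OF _ int_h that]) simp_all
  have ind_powr: "norm (indicator S x :: complex) \<le> (indicator S x :: real) powr s" for S s and x :: "real^'n"
    by (auto simp: indicator_def)
  have slice_ind: "integrable lborel (slice (?ind f u) (?ind g v) x)"
      "\<exists>B. \<forall>X. norm (wigner (?ind f u) (?ind g v) X) \<le> B" if "u \<in> ?U" "v \<in> ?V" for u v x
  proof -
    have uv: "u \<noteq> 0" "v \<noteq> 0" using that by auto
    note H = slice_Hoelder[OF _ _ ind_f[OF uv(1)] _ ind_g[OF uv(2)] _ _ _ ind_powr ind_powr, where s="1/2"]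
    show "integrable lborel (slice (?ind f u) (?ind g v) x)" by (rule H(1)) auto
    have "\<forall>X. norm (wigner (?ind f u) (?ind g v) X) \<le> (\<integral>x. indicator (f -` {u}) x \<partial>lborel) powr (1 / 2) *
      (\<integral>x. indicator (g -` {v}) x \<partial>lborel) powr (1 - 1 / 2) / (\<bar>det P\<bar> powr (1 / 2) * \<bar>det Q\<bar> powr (1 - 1 / 2))"
      by (intro allI order_trans[OF norm_wigner_le] H(2)) auto
    then show "\<exists>B. \<forall>X. norm (wigner (?ind f u) (?ind g v) X) \<le> B" by blast
  qed
  have int_K: "integrable lborel (\<lambda>X. wigner (?ind f u) (?ind g v) X * ?ind h w X)"
    if uvw: "u \<in> ?U" "v \<in> ?V" "w \<in> ?W" for u v w
  proof -
    obtain B where B: "\<And>X. norm (wigner (?ind f u) (?ind g v) X) \<le> B" using slice_ind(2)[OF uvw(1,2)] by blast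
    have w: "w \<noteq> 0" using uvw by auto
    show ?thesis
    proof (rule Bochner_Integration.integrable_bound)
      show "integrable lborel (\<lambda>X. complex_of_real B * ?ind h w X)"
        using ind_h[OF w] by simp
      show "(\<lambda>X. wigner (?ind f u) (?ind g v) X * ?ind h w X) \<in> borel_measurable lborel" by measurable
      show "AE X in lborel. norm (wigner (?ind f u) (?ind g v) X * ?ind h w X) \<le> norm (complex_of_real B * ?ind h w X)"
        using B by (auto simp: indicator_def norm_mult intro!: AE_I2 order_trans[OF B])
    qed
  qed
  have F_eq: "F z = (\<integral>X. wigner (f' z) (g' z) X * h' z X \<partial>lborel)" for z
  proof -
    have "wigner (f' z) (g' z) X * h' z X
       = (\<Sum>((u, v), w)\<in>?T. (\<phi> u z * \<psi> (cnj v) z * \<eta> w z) * (wigner (?ind f u) (?ind g v) X * ?ind h w X))" for X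
    proof -
      have "wigner (f' z) (g' z) X = (\<Sum>(u, v)\<in>?U \<times> ?V. (\<phi> u z * cnj (\<psi> v (cnj z))) * wigner (?ind f u) (?ind g v) X)"
        unfolding f'_sum[abs_def] g'_sum[abs_def] by (rule wigner_sum) (rule slice_ind)
      moreover have conj: "cnj (\<psi> v (cnj z)) = \<psi> (cnj v) z" for v
        by (simp add: \<psi>_def cnj_cpow)
      ultimately show ?thesis
        unfolding h'_sum by (simp only: sum_product sum.cartesian_product)
           (rule sum.cong[OF refl], auto simp: mult_ac)
    qed
    then have "(\<integral>X. wigner (f' z) (g' z) X * h' z X \<partial>lborel)
        = (\<integral>X. (\<Sum>((u, v), w)\<in>?T. (\<phi> u z * \<psi> (cnj v) z * \<eta> w z) * (wigner (?ind f u) (?ind g v) X * ?ind h w X)) \<partial>lborel)"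
      by (simp only:)
    also have "\<dots> = (\<Sum>((u, v), w)\<in>?T. (\<integral>X. (\<phi> u z * \<psi> (cnj v) z * \<eta> w z) * (wigner (?ind f u) (?ind g v) X * ?ind h w X) \<partial>lborel))"
      unfolding case_prod_beta'
      by (intro Bochner_Integration.integral_sum integrable_mult_right int_K) auto
    also have "\<dots> = F z"
      by (simp only: F_def K_def integral_mult_right_zero case_prod_beta' fst_conv snd_conv)
    finally show ?thesis ..
  qed
  have holo: "F holomorphic_on S" for S
    unfolding F_def \<phi>_def \<psi>_def \<eta>_def case_prod_beta'
    by (intro holomorphic_intros cpow_holomorphic)
  \<comment> \<open>The three lines theorem needs only some bound on the strip; the moduli of the exponentials have one
    that depends on the finitely many values of the simple functions.\<close>
  define C where "C = (\<Sum>((u, v), w)\<in>?T. exp (\<bar>ln (norm u)\<bar> * (\<bar>a0 / a\<bar> + \<bar>(1 / 2 - a0) / a\<bar>))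
      * exp (\<bar>ln (norm (cnj v))\<bar> * (\<bar>(1 - a0) / (1 - a)\<bar> + \<bar>(a0 - 1 / 2) / (1 - a)\<bar>))
      * exp (\<bar>ln (norm w)\<bar> * (\<bar>1 / (1 - b)\<bar> + \<bar>(- 1 / 2) / (1 - b)\<bar>)) * norm (K ((u, v), w)))"
  have bounded: "norm (F z) \<le> C" if "0 \<le> Re z" "Re z \<le> 1" for z
    unfolding F_def C_def \<phi>_def \<psi>_def \<eta>_def case_prod_beta'
    by (rule order_trans[OF norm_sum], rule sum_mono, unfold norm_mult)
       (intro mult_mono norm_cpow_le_strip that mult_nonneg_nonneg norm_ge_zero exp_ge_zero order_refl)
  let ?Pq = "\<bar>det P\<bar> powr a0 * \<bar>det Q\<bar> powr (1 - a0)"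
  define M0 where "M0 = Fa powr a0 * Ga powr (1 - a0) / ?Pq * Ha"
  define M1 where "M1 = (Fa * Ga) powr (1 / 2) * Ha powr (1 / 2)"
  have M: "0 < M0" "0 < M1" using Fa Ga Ha detP detQ by (auto simp: M0_def M1_def)
  have left: "norm (F z) \<le> M0" if z: "Re z = 0" for z
  proof -
    let ?u = "\<lambda>x. norm (f x) powr (1 / a)" and ?v = "\<lambda>x. norm (g x) powr (1 / (1 - a))"
    have nf: "norm (f' z x) \<le> ?u x powr a0" for x
      using z by (simp add: f'_def \<phi>_def norm_cpow powr_powr)
    have ng: "norm (g' z x) \<le> ?v x powr (1 - a0)" for x
      using z by (simp add: g'_def \<psi>_def norm_cpow powr_powr)
    have nh: "norm (h' z X) = norm (h X) powr (1 / (1 - b))" for X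
      using z by (simp add: h'_def \<eta>_def norm_cpow)
    have W: "norm (wigner (f' z) (g' z) X) \<le> Fa powr a0 * Ga powr (1 - a0) / ?Pq" for X
    proof -
      have "norm (wigner (f' z) (g' z) X) \<le> (\<integral>x. ?u x \<partial>lborel) powr a0 * (\<integral>x. ?v x \<partial>lborel) powr (1 - a0) / ?Pq"
        by (rule order_trans[OF norm_wigner_le]) (rule slice_Hoelder(2)[OF _ _ int_f _ int_g _ a0(1,2) nf ng]; simp)
      also have "\<dots> \<le> Fa powr a0 * Ga powr (1 - a0) / ?Pq"
        using Fa Ga a0 by (intro divide_right_mono mult_mono powr_mono2) auto
      finally show ?thesis .
    qed
    have "norm (F z) \<le> (\<integral>X. norm (wigner (f' z) (g' z) X * h' z X) \<partial>lborel)"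
      unfolding F_eq by (rule integral_norm_bound)
    also have "\<dots> \<le> (\<integral>X. Fa powr a0 * Ga powr (1 - a0) / ?Pq * norm (h X) powr (1 / (1 - b)) \<partial>lborel)"
    proof (rule integral_mono')
      show "norm (wigner (f' z) (g' z) X * h' z X) \<le> Fa powr a0 * Ga powr (1 - a0) / ?Pq * norm (h X) powr (1 / (1 - b))" for X
        unfolding norm_mult nh by (intro mult_right_mono W) simp
    qed (use int_h in simp_all)
    also have "\<dots> \<le> M0"
      unfolding M0_def using Ha by (simp add: mult_left_mono divide_right_mono)
    finally show ?thesis .
  qed
  have right: "norm (F z) \<le> M1" if z: "Re z = 1" for z
  proof -
    have half_sum: "2 * (c / x + d / x) = 1 / x" if "c + d = 1 / 2" for c d x :: real
      unfolding add_divide_distrib[symmetric] that by simp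
    have e: "2 * (a0 / a + (1 / 2 - a0) / a) = 1 / a" "2 * ((1 - a0) / (1 - a) + (a0 - 1 / 2) / (1 - a)) = 1 / (1 - a)"
       "2 * (1 / (1 - b) + (- 1 / 2) / (1 - b)) = 1 / (1 - b)"
      by (rule half_sum, simp)+
    have sq: "(x powr r)\<^sup>2 = x powr (2 * r)" for x r :: real
      by (simp add: power2_eq_square flip: powr_add)
    have nf: "(norm (f' z x))\<^sup>2 = norm (f x) powr (1 / a)" for x
      using z by (simp only: f'_def \<phi>_def norm_cpow sq mult_1_right e)
    have ng: "(norm (g' z x))\<^sup>2 = norm (g x) powr (1 / (1 - a))" for x
      using z by (simp only: g'_def \<psi>_def norm_cpow sq mult_1_right e cnj.sel)
    have nh: "(norm (h' z X))\<^sup>2 = norm (h X) powr (1 / (1 - b))" for X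
      using z by (simp only: h'_def \<eta>_def norm_cpow sq mult_1_right e)
    have L2: "(\<integral>\<^sup>+X. ennreal ((norm (wigner (f' z) (g' z) X))\<^sup>2) \<partial>lborel) \<le> ennreal (Fa * Ga)"
    proof -
      have "(\<integral>\<^sup>+X. ennreal ((norm (wigner (f' z) (g' z) X))\<^sup>2) \<partial>lborel)
         \<le> ennreal ((\<integral>x. norm (f x) powr (1 / a) \<partial>lborel) * (\<integral>x. norm (g x) powr (1 / (1 - a)) \<partial>lborel))"
        using wigner_L2_le[of "f' z" "g' z"] int_f int_g by (simp add: nf ng)
      also have "\<dots> \<le> ennreal (Fa * Ga)"
        using Fa Ga by (intro ennreal_leI mult_mono) auto
      finally show ?thesis .
    qed
    have int_W: "integrable lborel (\<lambda>X. (norm (wigner (f' z) (g' z) X))\<^sup>2)"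
      using L2 by (intro integrableI_bounded) (auto simp: top.not_eq_extremum intro: le_less_trans)
    have le_W: "(\<integral>X. (norm (wigner (f' z) (g' z) X))\<^sup>2 \<partial>lborel) \<le> Fa * Ga"
      using L2 Fa Ga by (simp add: nn_integral_eq_integral[OF int_W])
    have int_h': "integrable lborel (\<lambda>X. (norm (h' z X))\<^sup>2)" using int_h by (simp add: nh)
    have le_h: "(\<integral>X. (norm (h' z X))\<^sup>2 \<partial>lborel) \<le> Ha" using Ha by (simp add: nh)
    have half: "r\<^sup>2 powr (1 / 2) = r" if "r \<ge> 0" for r :: real
      using that by (simp add: powr_half_sqrt)
    note CS = weighted_Hoelder[OF int_W int_h' _ _, where s="1/2", simplified half norm_ge_zero]
    have "norm (F z) \<le> (\<integral>X. norm (wigner (f' z) (g' z) X * h' z X) \<partial>lborel)"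
      unfolding F_eq by (rule integral_norm_bound)
    also have "\<dots> = (\<integral>X. ((norm (wigner (f' z) (g' z) X))\<^sup>2) powr (1 / 2) * ((norm (h' z X))\<^sup>2) powr (1 - 1 / 2) \<partial>lborel)"
      by (simp add: half norm_mult)
    also have "\<dots> \<le> (\<integral>X. (norm (wigner (f' z) (g' z) X))\<^sup>2 \<partial>lborel) powr (1 / 2) * (\<integral>X. (norm (h' z X))\<^sup>2 \<partial>lborel) powr (1 - 1 / 2)"
      by (rule weighted_Hoelder(2)[OF int_W int_h']) auto
    also have "\<dots> \<le> (Fa * Ga) powr (1 / 2) * Ha powr (1 - 1 / 2)"
      by (intro mult_mono powr_mono2 le_W le_h) auto
    finally show ?thesis by (simp add: M1_def)
  qed
  have "norm (F ?\<theta>) \<le> M0 powr (1 - Re ?\<theta>) * M1 powr Re ?\<theta>"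
    by (rule Hadamard_three_lines[OF holo holomorphic_on_imp_continuous_on[OF holo] bounded M left right])
       (use b in auto)
  moreover have "F ?\<theta> = (\<integral>X. wigner f g X * h X \<partial>lborel)"
  proof -
    have "f' ?\<theta> = f" "g' ?\<theta> = g" "h' ?\<theta> = h"
      unfolding f'_def g'_def h'_def complex_cnj_complex_of_real \<theta> by auto
    then show ?thesis by (simp only: F_eq)
  qed
  moreover have "M0 powr (1 - 2 * b) * M1 powr (2 * b)
      = Fa powr a * Ga powr (1 - a) * Ha powr (1 - b) / (\<bar>det P\<bar> powr (a - b) * \<bar>det Q\<bar> powr (1 - a - b))"
  proof -
    have e1: "a0 * (1 - 2 * b) = a - b" using a0(3) by (simp add: mult.commute)
    have e2: "(1 - a0) * (1 - 2 * b) = 1 - a - b" using e1 by (simp add: algebra_simps)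
    have "M0 powr (1 - 2 * b) = Fa powr (a - b) * Ga powr (1 - a - b) / (\<bar>det P\<bar> powr (a - b) * \<bar>det Q\<bar> powr (1 - a - b)) * Ha powr (1 - 2 * b)"
      unfolding M0_def using Fa Ga Ha detP detQ by (simp add: powr_mult powr_divide powr_powr e1 e2)
    moreover have "M1 powr (2 * b) = Fa powr b * Ga powr b * Ha powr b"
      unfolding M1_def using Fa Ga Ha by (simp add: powr_mult powr_powr)
    moreover have "Fa powr (a - b) * Fa powr b = Fa powr a" "Ga powr (1 - a - b) * Ga powr b = Ga powr (1 - a)"
       "Ha powr (1 - 2 * b) * Ha powr b = Ha powr (1 - b)"
      by (simp_all flip: powr_add)
    ultimately show ?thesis
      by (simp add: field_simps) (metis (no_types, opaque_lifting) mult.assoc mult.commute)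
  qed
  ultimately show ?thesis by simp
qed

end

section \<open>From simple functions to Lebesgue spaces\<close>

lemma integrable_cball_indicator: "integrable lborel (indicator (cball (0::'a::euclidean_space) R) :: 'a \<Rightarrow> real)"
  by (rule integrable_real_indicator[OF _ emeasure_bounded_finite[OF bounded_cball]]) simp

lemma tendsto_integral_powr_dominated:
  fixes s :: "nat \<Rightarrow> 'a \<Rightarrow> complex"
  assumes [measurable]: "\<And>i. s i \<in> borel_measurable N" "f \<in> borel_measurable N"
    and int: "integrable N w"
    and r: "r > 0"
    and lim: "AE x in N. (\<lambda>i. s i x) \<longlonglongrightarrow> f x"
    and bound: "\<And>i. AE x in N. norm (s i x) powr r \<le> w x"
  shows "integrable N (\<lambda>x. norm (s i x) powr r)"
    and "(\<lambda>i. \<integral>x. norm (s i x) powr r \<partial>N) \<longlonglongrightarrow> (\<integral>x. norm (f x) powr r \<partial>N)"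
proof -
  have lim': "AE x in N. (\<lambda>i. norm (s i x) powr r) \<longlonglongrightarrow> norm (f x) powr r"
    using lim by eventually_elim (intro tendsto_powr' tendsto_norm, use r in auto)
  have bound': "AE x in N. norm (norm (s i x) powr r) \<le> w x" for i using bound by simp
  note dc = integrable_dominated_convergence2[OF _ _ int lim' bound']
    integral_dominated_convergence[OF _ _ int lim' bound']
  show "integrable N (\<lambda>x. norm (s i x) powr r)" by (rule dc) measurable
  show "(\<lambda>i. \<integral>x. norm (s i x) powr r \<partial>N) \<longlonglongrightarrow> (\<integral>x. norm (f x) powr r \<partial>N)" by (rule dc) measurable
qed

lemma simple_Lp_approximation:
  fixes f :: "'a \<Rightarrow> complex"
  assumes f[measurable]: "f \<in> borel_measurable N" and sp: "space N = UNIV"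
    and int: "integrable N (\<lambda>x. norm (f x) powr r)" and r: "r > 0"
  obtains s where "\<And>i. simple_function N (s i)" "\<And>x. (\<lambda>i. s i x) \<longlonglongrightarrow> f x"
    "\<And>i x. norm (s i x) \<le> 2 * norm (f x)"
    "\<And>i. integrable N (\<lambda>x. norm (s i x) powr r)"
    "(\<lambda>i. \<integral>x. norm (s i x) powr r \<partial>N) \<longlonglongrightarrow> (\<integral>x. norm (f x) powr r \<partial>N)"
proof -
  obtain s where s: "\<And>i. simple_function N (s i)" "\<And>x. (\<lambda>i. s i x) \<longlonglongrightarrow> f x"
      "\<And>i x. norm (s i x) \<le> 2 * norm (f x)"
    using borel_measurable_implies_sequence_metric[OF f, of 0] sp by auto
  have [measurable]: "s i \<in> borel_measurable N" for i by (rule borel_measurable_simple_function[OF s(1)])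
  have bound: "norm (s i x) powr r \<le> 2 powr r * norm (f x) powr r" for i x
    using powr_mono2[OF _ _ s(3)[of i x], of r] r by (simp add: powr_mult)
  have w: "integrable N (\<lambda>x. 2 powr r * norm (f x) powr r)" using int by simp
  show thesis
    by (rule that[OF s]; rule tendsto_integral_powr_dominated[OF _ f w r]) (auto simp: s(2) bound)
qed

context wigner_pair
begin

lemma wigner_bounded:
  assumes [measurable]: "f \<in> borel_measurable borel" "g \<in> borel_measurable borel"
    and a: "0 < a" "a < 1"
    and f: "integrable lborel (\<lambda>x. norm (f x) powr (1 / a))"
    and g: "integrable lborel (\<lambda>x. norm (g x) powr (1 / (1 - a)))"
  shows "integrable lborel (slice f g x)"
    and "norm (wigner f g X) \<le> (\<integral>x. norm (f x) powr (1 / a) \<partial>lborel) powr a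
       * (\<integral>x. norm (g x) powr (1 / (1 - a)) \<partial>lborel) powr (1 - a) / (\<bar>det P\<bar> powr a * \<bar>det Q\<bar> powr (1 - a))"
proof -
  note H = slice_Hoelder[OF _ _ f _ g, where s=a]
  show "integrable lborel (slice f g x)"
    by (rule H(1)) (use a in \<open>auto simp: powr_powr\<close>)
  show "norm (wigner f g X) \<le> (\<integral>x. norm (f x) powr (1 / a) \<partial>lborel) powr a
       * (\<integral>x. norm (g x) powr (1 / (1 - a)) \<partial>lborel) powr (1 - a) / (\<bar>det P\<bar> powr a * \<bar>det Q\<bar> powr (1 - a))"
    by (rule order_trans[OF norm_wigner_le]) (rule H(2), use a in \<open>auto simp: powr_powr\<close>)
qed

text \<open>Duality without the dual space: the extremal test function \<open>\<bar>W\<bar> powr (q - 2) * cnj W\<close>, cut off to a ball,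
  is a limit of simple functions. Inserting it into the interpolation estimate bounds the integral \<open>A\<close> of
  \<open>\<bar>W\<bar> powr q\<close> over the ball by \<open>D * A powr (1 - b)\<close>, where \<open>b = 1/q\<close>. As \<open>A\<close> is finite,
  \<open>A powr b \<le> D\<close>, and the balls may then exhaust the space.\<close>

lemma wigner_Lq_simple:
  assumes f: "simple_function lborel f" and g: "simple_function lborel g"
    and a: "0 < a" "a < 1" and b: "0 < b" "b \<le> 1 / 2" "b \<le> a" "a \<le> 1 - b"
    and int_f: "integrable lborel (\<lambda>x. norm (f x) powr (1 / a))"
    and int_g: "integrable lborel (\<lambda>x. norm (g x) powr (1 / (1 - a)))"
    and Fa: "0 < Fa" "(\<integral>x. norm (f x) powr (1 / a) \<partial>lborel) \<le> Fa"
    and Ga: "0 < Ga" "(\<integral>x. norm (g x) powr (1 / (1 - a)) \<partial>lborel) \<le> Ga"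
  shows "(\<integral>\<^sup>+X. ennreal (norm (wigner f g X) powr (1 / b)) \<partial>lborel)
    \<le> ennreal ((Fa powr a * Ga powr (1 - a) / (\<bar>det P\<bar> powr (a - b) * \<bar>det Q\<bar> powr (1 - a - b))) powr (1 / b))"
    (is "_ \<le> ennreal (?D powr (1 / b))")
proof (rule nn_integral_Fatou_bound)
  note [measurable] = borel_measurable_simple_function[OF f, simplified]
    borel_measurable_simple_function[OF g, simplified]
  let ?W = "wigner f g"
  let ?I = "\<lambda>n::nat. indicator (cball 0 (real n)) :: (real^'n) \<times> (real^'n) \<Rightarrow> real"
  define u where "u = (\<lambda>n X. ?I n X * norm (?W X) powr (1 / b))"
  have D0: "?D \<ge> 0" by simp
  obtain C where C: "\<And>X. norm (?W X) \<le> C"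
    by (rule that, rule wigner_bounded(2)[OF _ _ a int_f int_g]) simp_all
  have [measurable]: "cball (0::(real^'n) \<times> (real^'n)) (real n) \<in> sets borel" for n by simp
  have W_meas[measurable]: "?W \<in> borel_measurable borel" by simp
  show meas_u[measurable]: "u n \<in> borel_measurable lborel" for n
    unfolding u_def by measurable
  show "(\<lambda>n. u n X) \<longlonglongrightarrow> norm (?W X) powr (1 / b)" for X
  proof (rule tendsto_eventually)
    obtain N where N: "norm X \<le> real N" using real_arch_simple by blast
    show "\<forall>\<^sub>F n in sequentially. u n X = norm (?W X) powr (1 / b)"
      using eventually_ge_at_top[of N] by eventually_elim (use N in \<open>auto simp: u_def\<close>)
  qed
  show "(\<integral>\<^sup>+X. ennreal (u n X) \<partial>lborel) \<le> ennreal (?D powr (1 / b))" for n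
  proof -
    have int_I: "integrable lborel (?I n)"
      by (rule integrable_cball_indicator)
    have int_u: "integrable lborel (u n)"
    proof (rule Bochner_Integration.integrable_bound)
      show "integrable lborel (\<lambda>X. C powr (1 / b) * ?I n X)" using int_I by simp
      have "norm (?W X) powr (1 / b) \<le> C powr (1 / b)" for X
        using C b by (intro powr_mono2) auto
      then show "AE X in lborel. norm (u n X) \<le> norm (C powr (1 / b) * ?I n X)"
        by (auto simp: u_def indicator_def)
    qed simp
    have u0: "u n X \<ge> 0" for X by (simp add: u_def)
    define A where "A = (\<integral>X. u n X \<partial>lborel)"
    have A0: "A \<ge> 0" unfolding A_def by (simp add: u_def)
    \<comment> \<open>Normalised so that \<open>?W X * h X\<close> and the power of \<open>\<bar>h X\<bar>\<close> with the conjugate exponent are both equal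
      to \<open>u n X\<close>; where \<open>?W X = 0\<close>, the factor \<open>cnj (?W X)\<close> makes \<open>h X\<close> zero.\<close>
    define h where "h = (\<lambda>X. complex_of_real (?I n X * norm (?W X) powr (1 / b - 2)) * cnj (?W X))"
    have [measurable]: "h \<in> borel_measurable borel" unfolding h_def by measurable
    have Wh: "?W X * h X = complex_of_real (u n X)" for X
    proof (cases "?W X = 0")
      case False
      have "?W X * h X = complex_of_real (?I n X * norm (?W X) powr (1 / b - 2)) * (?W X * cnj (?W X))"
        by (simp add: h_def mult_ac)
      also have "\<dots> = complex_of_real (?I n X * (norm (?W X) powr (1 / b - 2) * (norm (?W X))\<^sup>2))"
        by (simp add: complex_norm_square[symmetric])
      also have "norm (?W X) powr (1 / b - 2) * (norm (?W X))\<^sup>2 = norm (?W X) powr (1 / b)"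
        using False by (simp add: powr_diff)
      finally show ?thesis by (simp add: u_def)
    qed (simp add: u_def h_def)
    have nh: "norm (h X) powr (1 / (1 - b)) = u n X" for X
    proof (cases "?W X = 0")
      case False
      have "norm (h X) = ?I n X * (norm (?W X) powr (1 / b - 2) * norm (?W X))"
        by (simp add: h_def norm_mult)
      also have "norm (?W X) powr (1 / b - 2) * norm (?W X) = norm (?W X) powr (1 / b - 1)"
        using False by (simp add: powr_diff power2_eq_square)
      finally have "norm (h X) = ?I n X * norm (?W X) powr (1 / b - 1)" .
      moreover have "(1 / b - 1) * (1 / (1 - b)) = 1 / b" using b by (simp add: field_simps)
      ultimately show ?thesis by (auto simp: u_def indicator_def powr_powr)
    qed (simp add: u_def h_def)
    have r: "1 / (1 - b) > 0" using b by simp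
    have h_meas: "h \<in> borel_measurable lborel" by simp
    have sp2: "space (lborel :: ((real^'n) \<times> (real^'n)) measure) = UNIV" by simp
    have int_h: "integrable lborel (\<lambda>X. norm (h X) powr (1 / (1 - b)))" by (simp add: nh int_u)
    obtain s where s: "\<And>i. simple_function lborel (s i)" "\<And>X. (\<lambda>i. s i X) \<longlonglongrightarrow> h X"
      "\<And>i X. norm (s i X) \<le> 2 * norm (h X)"
      "\<And>i. integrable lborel (\<lambda>X. norm (s i X) powr (1 / (1 - b)))"
      "(\<lambda>i. \<integral>X. norm (s i X) powr (1 / (1 - b)) \<partial>lborel) \<longlonglongrightarrow> (\<integral>X. norm (h X) powr (1 / (1 - b)) \<partial>lborel)"
      using simple_Lp_approximation[OF h_meas sp2 int_h r] by blast
    have [measurable]: "s i \<in> borel_measurable borel" for i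
      using borel_measurable_simple_function[OF s(1)] by simp
    let ?H = "\<lambda>i. (\<integral>X. norm (s i X) powr (1 / (1 - b)) \<partial>lborel) + inverse (real (Suc i))"
    have le: "norm (\<integral>X. ?W X * s i X \<partial>lborel) \<le> ?D * ?H i powr (1 - b)" for i
    proof -
      have "0 < ?H i" by (intro add_nonneg_pos) auto
      then have "norm (\<integral>X. ?W X * s i X \<partial>lborel)
        \<le> Fa powr a * Ga powr (1 - a) * ?H i powr (1 - b) / (\<bar>det P\<bar> powr (a - b) * \<bar>det Q\<bar> powr (1 - a - b))"
        by (intro wigner_interpolation_simple f g s a b int_f int_g Fa Ga) auto
      then show ?thesis by simp
    qed
    have "(\<lambda>i. \<integral>X. ?W X * s i X \<partial>lborel) \<longlonglongrightarrow> (\<integral>X. ?W X * h X \<partial>lborel)"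
    proof (rule integral_dominated_convergence)
      show "integrable lborel (\<lambda>X. 2 * u n X)" using int_u by simp
      show "AE X in lborel. (\<lambda>i. ?W X * s i X) \<longlonglongrightarrow> ?W X * h X"
        by (intro AE_I2 tendsto_intros s)
      have "norm (?W X * s i X) \<le> 2 * u n X" for i X
      proof -
        have "norm (?W X * s i X) \<le> norm (?W X) * (2 * norm (h X))"
          unfolding norm_mult by (rule mult_left_mono[OF s(3)]) simp
        also have "\<dots> = 2 * norm (?W X * h X)" by (simp add: norm_mult)
        also have "\<dots> = 2 * u n X" unfolding Wh norm_of_real using u0 by simp
        finally show ?thesis .
      qed
      then show "AE X in lborel. norm (?W X * s i X) \<le> 2 * u n X" for i by simp
    qed measurable
    then have "(\<lambda>i. norm (\<integral>X. ?W X * s i X \<partial>lborel)) \<longlonglongrightarrow> norm (\<integral>X. ?W X * h X \<partial>lborel)"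
      by (rule tendsto_norm)
    also have "norm (\<integral>X. ?W X * h X \<partial>lborel) = A"
      unfolding Wh A_def[symmetric] integral_complex_of_real using A0 by simp
    finally have limA: "(\<lambda>i. norm (\<integral>X. ?W X * s i X \<partial>lborel)) \<longlonglongrightarrow> A" .
    have "?H \<longlonglongrightarrow> A + 0"
      using s(5) unfolding nh A_def[symmetric] by (intro tendsto_add LIMSEQ_inverse_real_of_nat)
    then have "(\<lambda>i. ?D * ?H i powr (1 - b)) \<longlonglongrightarrow> ?D * (A + 0) powr (1 - b)"
      using b by (intro tendsto_mult_left tendsto_powr' tendsto_const) auto
    with limA have AD: "A \<le> ?D * A powr (1 - b)"
      using le by (intro LIMSEQ_le[where X="\<lambda>i. norm (\<integral>X. ?W X * s i X \<partial>lborel)"]) auto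
    have "A \<le> ?D powr (1 / b)"
    proof (cases "A = 0")
      case False
      then have "A > 0" using A0 by simp
      have "A powr b = A / A powr (1 - b)" using \<open>A > 0\<close> by (simp add: powr_diff)
      also have "\<dots> \<le> ?D" using AD \<open>A > 0\<close> by (simp add: pos_divide_le_eq)
      finally have "(A powr b) powr (1 / b) \<le> ?D powr (1 / b)"
        using b by (intro powr_mono2) auto
      then show ?thesis using b \<open>A > 0\<close> by (simp add: powr_powr)
    qed simp
    then show ?thesis
      using int_u unfolding A_def by (subst nn_integral_eq_integral) (auto simp: u_def)
  qed
qed simp

lemma wigner_tendsto:
  assumes [measurable]: "f \<in> borel_measurable borel" "g \<in> borel_measurable borel"
    "\<And>i. s i \<in> borel_measurable borel" "\<And>i. t i \<in> borel_measurable borel"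
    and int: "integrable lborel (slice f g (fst X))"
    and s: "\<And>x. (\<lambda>i. s i x) \<longlonglongrightarrow> f x" "\<And>i x. norm (s i x) \<le> 2 * norm (f x)"
    and t: "\<And>x. (\<lambda>i. t i x) \<longlonglongrightarrow> g x" "\<And>i x. norm (t i x) \<le> 2 * norm (g x)"
  shows "(\<lambda>i. wigner (s i) (t i) X) \<longlonglongrightarrow> wigner f g X"
  unfolding wigner_def fourier_def
proof (rule integral_dominated_convergence)
  show "integrable lborel (\<lambda>y. 4 * norm (slice f g (fst X) y))" using int by simp
  show "AE y in lborel. (\<lambda>i. cis (- (2 * pi * (snd X \<bullet> y))) * slice (s i) (t i) (fst X) y)
      \<longlonglongrightarrow> cis (- (2 * pi * (snd X \<bullet> y))) * slice f g (fst X) y"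
    unfolding slice_def by (intro AE_I2 tendsto_intros s t)
  have "norm (slice (s i) (t i) x y) \<le> 4 * norm (slice f g x y)" for i x y
  proof -
    have "norm (slice (s i) (t i) x y) \<le> (2 * norm (f (x + P *v y))) * (2 * norm (g (x + Q *v y)))"
      unfolding slice_def norm_mult complex_mod_cnj by (intro mult_mono s t) auto
    then show ?thesis by (simp add: slice_def norm_mult)
  qed
  then show "AE y in lborel. norm (cis (- (2 * pi * (snd X \<bullet> y))) * slice (s i) (t i) (fst X) y)
      \<le> 4 * norm (slice f g (fst X) y)" for i
    by (simp add: norm_mult)
qed (unfold slice_def, measurable)

text \<open>Simple functions \<open>s i \<rightarrow> f\<close> and \<open>t i \<rightarrow> g\<close> dominated by \<open>2\<bar>f\<bar>\<close> and \<open>2\<bar>g\<bar>\<close> make the bilinear forms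
  converge pointwise and their norms converge to those of \<open>f\<close> and \<open>g\<close>, so Fatou's lemma carries the
  estimate over. Adding \<open>1/(i+1)\<close> to the integrals keeps the bounds for the simple functions positive.\<close>

lemma wigner_Lq:
  assumes [measurable]: "f \<in> borel_measurable borel" "g \<in> borel_measurable borel"
    and a: "0 < a" "a < 1" and b: "0 < b" "b \<le> 1 / 2" "b \<le> a" "a \<le> 1 - b"
    and f: "integrable lborel (\<lambda>x. norm (f x) powr (1 / a))"
    and g: "integrable lborel (\<lambda>x. norm (g x) powr (1 / (1 - a)))"
  shows "(\<integral>\<^sup>+X. ennreal (norm (wigner f g X) powr (1 / b)) \<partial>lborel)
    \<le> ennreal (((\<integral>x. norm (f x) powr (1 / a) \<partial>lborel) powr a * (\<integral>x. norm (g x) powr (1 / (1 - a)) \<partial>lborel) powr (1 - a)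
        / (\<bar>det P\<bar> powr (a - b) * \<bar>det Q\<bar> powr (1 - a - b))) powr (1 / b))"
proof -
  have f_meas: "f \<in> borel_measurable lborel" and g_meas: "g \<in> borel_measurable lborel" by simp_all
  have sp: "space (lborel :: (real^'n) measure) = UNIV" by simp
  have a': "1 / a > 0" "1 / (1 - a) > 0" using a by auto
  obtain s where s: "\<And>i. simple_function lborel (s i)" "\<And>X. (\<lambda>i. s i X) \<longlonglongrightarrow> f X"
      "\<And>i X. norm (s i X) \<le> 2 * norm (f X)"
      "\<And>i. integrable lborel (\<lambda>X. norm (s i X) powr (1 / a))"
      "(\<lambda>i. \<integral>X. norm (s i X) powr (1 / a) \<partial>lborel) \<longlonglongrightarrow> (\<integral>X. norm (f X) powr (1 / a) \<partial>lborel)"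
    using simple_Lp_approximation[OF f_meas sp f a'(1)] by blast
  obtain t where t: "\<And>i. simple_function lborel (t i)" "\<And>X. (\<lambda>i. t i X) \<longlonglongrightarrow> g X"
      "\<And>i X. norm (t i X) \<le> 2 * norm (g X)"
      "\<And>i. integrable lborel (\<lambda>X. norm (t i X) powr (1 / (1 - a)))"
      "(\<lambda>i. \<integral>X. norm (t i X) powr (1 / (1 - a)) \<partial>lborel) \<longlonglongrightarrow> (\<integral>X. norm (g X) powr (1 / (1 - a)) \<partial>lborel)"
    using simple_Lp_approximation[OF g_meas sp g a'(2)] by blast
  have [measurable]: "s i \<in> borel_measurable borel" "t i \<in> borel_measurable borel" for i
    using borel_measurable_simple_function[OF s(1)] borel_measurable_simple_function[OF t(1)] by simp_all
  let ?A = "\<lambda>i. (\<integral>X. norm (s i X) powr (1 / a) \<partial>lborel) + inverse (real (Suc i))"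
  let ?B = "\<lambda>i. (\<integral>X. norm (t i X) powr (1 / (1 - a)) \<partial>lborel) + inverse (real (Suc i))"
  let ?D = "\<lambda>A B. (A powr a * B powr (1 - a) / (\<bar>det P\<bar> powr (a - b) * \<bar>det Q\<bar> powr (1 - a - b))) powr (1 / b)"
  have det: "det P \<noteq> 0" "det Q \<noteq> 0" using invertible_P invertible_Q by (auto simp: invertible_det_nz)
  have pos: "0 < ?A i" "0 < ?B i" for i by (intro add_nonneg_pos; simp)+
  show ?thesis
  proof (rule nn_integral_Fatou_bound[where c="\<lambda>i. ennreal (?D (?A i) (?B i))"])
    show "(\<lambda>i. norm (wigner (s i) (t i) X) powr (1 / b)) \<longlonglongrightarrow> norm (wigner f g X) powr (1 / b)" for X
    proof -
      have "(\<lambda>i. wigner (s i) (t i) X) \<longlonglongrightarrow> wigner f g X"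
        by (rule wigner_tendsto) (simp_all add: s t wigner_bounded(1)[OF _ _ a f g])
      then show ?thesis using b by (intro tendsto_powr' tendsto_norm) auto
    qed
    show "(\<integral>\<^sup>+X. ennreal (norm (wigner (s i) (t i) X) powr (1 / b)) \<partial>lborel) \<le> ennreal (?D (?A i) (?B i))" for i
      by (rule wigner_Lq_simple[OF s(1) t(1) a b s(4) t(4) pos(1) _ pos(2)]) simp_all
    have "?A \<longlonglongrightarrow> (\<integral>x. norm (f x) powr (1 / a) \<partial>lborel) + 0" "?B \<longlonglongrightarrow> (\<integral>x. norm (g x) powr (1 / (1 - a)) \<partial>lborel) + 0"
      by (intro tendsto_add s t LIMSEQ_inverse_real_of_nat)+
    then have "(\<lambda>i. ?D (?A i) (?B i)) \<longlonglongrightarrow> ?D (\<integral>x. norm (f x) powr (1 / a) \<partial>lborel) (\<integral>x. norm (g x) powr (1 / (1 - a)) \<partial>lborel)"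
      using a b pos det
      by (intro tendsto_powr' tendsto_divide tendsto_mult tendsto_const) (auto intro: less_imp_le always_eventually)
    then show "(\<lambda>i. ennreal (?D (?A i) (?B i))) \<longlonglongrightarrow> ennreal (?D (\<integral>x. norm (f x) powr (1 / a) \<partial>lborel) (\<integral>x. norm (g x) powr (1 / (1 - a)) \<partial>lborel))"
      by (rule tendsto_ennrealI)
  qed measurable
qed

end

section \<open>Continuity and decay at infinity\<close>

text \<open>The radius is a parameter because it fixes the balls that carry the slices and the dominating functions
  below.\<close>

definition compact_support :: "('a::real_normed_vector \<Rightarrow> complex) \<Rightarrow> real \<Rightarrow> bool" where
  "compact_support u R \<longleftrightarrow> continuous_on UNIV u \<and> (\<forall>x. R < norm x \<longrightarrow> u x = 0)"

lemma compact_support_bounded: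
  fixes u :: "'a::euclidean_space \<Rightarrow> complex"
  assumes "compact_support u R"
  obtains C where "C \<ge> 0" "\<And>x. norm (u x) \<le> C"
proof -
  have "compact (u ` cball 0 R)"
    using assms continuous_on_subset[of UNIV u "cball 0 R"]
    by (intro compact_continuous_image) (auto simp: compact_support_def)
  then have "bounded (u ` cball 0 R)" by (rule compact_imp_bounded)
  then obtain C where C: "\<And>x. x \<in> cball 0 R \<Longrightarrow> norm (u x) \<le> C"
    unfolding bounded_iff by blast
  have "norm (u x) \<le> max C 0" for x
    using C[of x] assms by (cases "norm x \<le> R") (auto simp: compact_support_def le_max_iff_disj)
  then show thesis by (intro that[of "max C 0"]) auto
qed

lemma compact_support_uniformly_continuous:
  fixes u :: "'a::euclidean_space \<Rightarrow> complex"
  assumes u: "compact_support u R" and e: "e > 0"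
  obtains d where "d > 0" "\<And>x y. norm (x - y) < d \<Longrightarrow> norm (u x - u y) < e"
proof -
  have "uniformly_continuous_on (cball 0 (R + 1)) u"
    using u continuous_on_subset[of UNIV u "cball 0 (R + 1)"]
    by (intro compact_uniformly_continuous) (auto simp: compact_support_def)
  then obtain d where d: "d > 0" "\<And>x y. \<lbrakk>x \<in> cball 0 (R + 1); y \<in> cball 0 (R + 1); dist y x < d\<rbrakk> \<Longrightarrow> dist (u y) (u x) < e"
    using e unfolding uniformly_continuous_on_def by blast
  show thesis
  proof (rule that[of "min d 1"])
    fix x y :: 'a assume xy: "norm (x - y) < min d 1"
    have *: "norm x \<le> norm y + norm (x - y)" "norm y \<le> norm x + norm (x - y)"
      using norm_triangle_sub[of x y] norm_triangle_sub[of y x] by (simp_all add: norm_minus_commute)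
    show "norm (u x - u y) < e"
    proof (cases "x \<in> cball 0 (R + 1) \<and> y \<in> cball 0 (R + 1)")
      case True
      then show ?thesis using d(2)[of y x] xy by (simp add: dist_norm)
    next
      case False
      then have "R < norm x" "R < norm y" using * xy by (auto simp: min_def split: if_splits)
      then have "u x = 0" "u y = 0" using u by (auto simp: compact_support_def)
      then show ?thesis using e by simp
    qed
  qed (use d in auto)
qed

lemma borel_measurable_compact_support:
  fixes u :: "'a::euclidean_space \<Rightarrow> complex"
  shows "compact_support u R \<Longrightarrow> u \<in> borel_measurable borel"
  by (auto simp: compact_support_def intro: borel_measurable_continuous_onI)

lemma integrable_compact_support:
  fixes u :: "'a::euclidean_space \<Rightarrow> complex"
  assumes u: "compact_support u R" and r: "r > 0"
  shows "integrable lborel (\<lambda>x. norm (u x) powr r)"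
proof -
  obtain C where C: "C \<ge> 0" "\<And>x. norm (u x) \<le> C" using compact_support_bounded[OF u] by blast
  have [measurable]: "u \<in> borel_measurable borel" by (rule borel_measurable_compact_support[OF u])
  show ?thesis
  proof (rule Bochner_Integration.integrable_bound)
    show "integrable lborel (\<lambda>x::'a. C powr r * indicator (cball 0 R) x)"
      by (intro integrable_mult_right integrable_cball_indicator)
    show "AE x in lborel. norm (norm (u x) powr r) \<le> norm (C powr r * indicator (cball 0 R) x)"
      using u C r by (auto simp: indicator_def compact_support_def not_le intro!: powr_mono2)
  qed measurable
qed

text \<open>A measurable function is almost everywhere the limit of continuous functions. Clamping these to the
  ball that contains the values of \<open>f\<close> and multiplying by a continuous cutoff makes them dominated, and turns convergence almost
  everywhere into convergence in the mean of order \<open>r\<close>.\<close>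

lemma compact_support_dense_bounded:
  fixes f :: "'a::euclidean_space \<Rightarrow> complex"
  assumes [measurable]: "f \<in> borel_measurable borel"
    and C: "C > 0" "\<And>x. norm (f x) \<le> C" and R: "\<And>x. R < norm x \<Longrightarrow> f x = 0"
    and r: "r > 0" and e: "e > 0"
  obtains u where "compact_support u (R + 1)"
    "integrable lborel (\<lambda>x. norm (f x - u x) powr r)" "(\<integral>x. norm (f x - u x) powr r \<partial>lborel) < e"
proof -
  have "f \<in> borel_measurable (lebesgue_on UNIV)"
    by (simp add: lebesgue_on_UNIV_eq measurable_completion)
  then have "f measurable_on UNIV" using measurable_on_iff_borel_measurable[of UNIV f] by simp
  then obtain N c where N: "negligible N" and c: "\<And>n. continuous_on UNIV (c n)"
      "\<And>x. x \<notin> N \<Longrightarrow> (\<lambda>n. c n x) \<longlonglongrightarrow> f x"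
    unfolding measurable_on_def by auto
  define clamp where "clamp = (\<lambda>w::complex. (C / max C (norm w)) *\<^sub>R w)"
  define \<rho> where "\<rho> = (\<lambda>x::'a. max 0 (min 1 (R + 1 - norm x)))"
  define u where "u = (\<lambda>n x. \<rho> x *\<^sub>R clamp (c n x))"
  have cont_clamp: "continuous_on UNIV clamp"
    unfolding clamp_def using C by (intro continuous_intros) auto
  have clamp_le: "norm (clamp w) \<le> C" for w
    using C by (auto simp: clamp_def max_def field_simps)
  have clamp_id: "clamp w = w" if "norm w \<le> C" for w
    using C that by (simp add: clamp_def max_def)
  have cont_u: "continuous_on UNIV (u n)" for n
    unfolding u_def \<rho>_def
    by (intro continuous_intros continuous_on_compose2[OF cont_clamp c(1)]) auto
  have [measurable]: "u n \<in> borel_measurable borel" for n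
    by (rule borel_measurable_continuous_onI[OF cont_u])
  have supp: "compact_support (u n) (R + 1)" for n
    using cont_u by (auto simp: compact_support_def u_def \<rho>_def)
  have \<rho>f: "\<rho> x *\<^sub>R f x = f x" for x using R[of x] by (cases "R < norm x") (auto simp: \<rho>_def)
  have lim: "(\<lambda>n. f x - u n x) \<longlonglongrightarrow> 0" if "x \<notin> N" for x
  proof -
    have "isCont clamp (f x)" using cont_clamp by (simp add: continuous_on_eq_continuous_at)
    then have "(\<lambda>n. clamp (c n x)) \<longlonglongrightarrow> clamp (f x)" using c(2)[OF that] by (rule isCont_tendsto_compose)
    then have "(\<lambda>n. f x - u n x) \<longlonglongrightarrow> f x - \<rho> x *\<^sub>R clamp (f x)"
      unfolding u_def by (intro tendsto_intros)
    then show ?thesis by (simp add: clamp_id C \<rho>f)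
  qed
  have "AE x in lebesgue. x \<notin> N"
    using N by (simp add: negligible_iff_null_sets AE_not_in)
  then have "AE x in lborel. x \<notin> N" by (simp add: AE_completion_iff)
  then have ae: "AE x in lborel. (\<lambda>n. f x - u n x) \<longlonglongrightarrow> (\<lambda>_. 0) x"
    by eventually_elim (simp add: lim)
  have bound: "norm (f x - u n x) powr r \<le> (2 * C) powr r * indicator (cball 0 (R + 1)) x" for n x
  proof (cases "norm x \<le> R + 1")
    case True
    have "norm (u n x) \<le> 1 * C"
      unfolding u_def norm_scaleR by (intro mult_mono clamp_le) (auto simp: \<rho>_def)
    then have "norm (f x - u n x) \<le> 2 * C"
      using C(2)[of x] norm_triangle_ineq4[of "f x" "u n x"] by simp
    then have "norm (f x - u n x) powr r \<le> (2 * C) powr r" using r by (intro powr_mono2) auto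
    then show ?thesis using True by simp
  next
    case False
    then have "f x = 0" "u n x = 0" using R[of x] supp[of n] by (auto simp: compact_support_def)
    then show ?thesis by simp
  qed
  have w: "integrable lborel (\<lambda>x::'a. (2 * C) powr r * indicator (cball 0 (R + 1)) x)"
    by (intro integrable_mult_right integrable_cball_indicator)
  note conv = tendsto_integral_powr_dominated[OF _ _ w r ae AE_I2[OF bound]]
  have int: "integrable lborel (\<lambda>x. norm (f x - u n x) powr r)" for n
    by (rule conv(1)) measurable
  have "(\<lambda>n. \<integral>x. norm (f x - u n x) powr r \<partial>lborel) \<longlonglongrightarrow> (\<integral>(x::'a). norm (0::complex) powr r \<partial>lborel)"
    by (rule conv(2)) measurable
  then have "\<forall>\<^sub>F n in sequentially. (\<integral>x. norm (f x - u n x) powr r \<partial>lborel) < e"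
    using e by (intro order_tendstoD(2)[where y=0]) auto
  then obtain n where "(\<integral>x. norm (f x - u n x) powr r \<partial>lborel) < e"
    by (auto simp: eventually_sequentially)
  then show thesis using that[OF supp int] by blast
qed

lemma powr_sum_le:
  fixes x y r :: real
  assumes "0 \<le> x" "0 \<le> y" "0 < r"
  shows "(x + y) powr r \<le> 2 powr r * (x powr r + y powr r)"
proof -
  have "(x + y) powr r \<le> (2 * max x y) powr r" using assms by (intro powr_mono2) auto
  also have "\<dots> = 2 powr r * (max x y) powr r" using assms by (simp add: powr_mult)
  also have "\<dots> \<le> 2 powr r * (x powr r + y powr r)" by (intro mult_left_mono) (auto simp: max_def)
  finally show ?thesis .
qed

lemma compact_support_dense:
  fixes f :: "'a::euclidean_space \<Rightarrow> complex"
  assumes [measurable]: "f \<in> borel_measurable borel"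
    and f: "integrable lborel (\<lambda>x. norm (f x) powr r)" and r: "r > 0" and e: "e > 0"
  obtains u R where "compact_support u R"
    "integrable lborel (\<lambda>x. norm (f x - u x) powr r)" "(\<integral>x. norm (f x - u x) powr r \<partial>lborel) < e"
proof -
  \<comment> \<open>First cut off \<open>f\<close> in range and domain, then approximate the truncation.\<close>
  define t where "t = (\<lambda>n x. if norm (f x) \<le> real n \<and> norm x \<le> real n then f x else 0)"
  have [measurable]: "t n \<in> borel_measurable borel" for n unfolding t_def by measurable
  have lim: "AE x in lborel. (\<lambda>n. f x - t n x) \<longlonglongrightarrow> (\<lambda>_. 0) x"
  proof (rule AE_I2)
    fix x
    obtain m where m: "max (norm (f x)) (norm x) \<le> real m" using real_arch_simple by blast
    show "(\<lambda>n. f x - t n x) \<longlonglongrightarrow> 0"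
    proof (rule tendsto_eventually)
      show "\<forall>\<^sub>F n in sequentially. f x - t n x = 0"
        using eventually_ge_at_top[of m] by eventually_elim (use m in \<open>auto simp: t_def\<close>)
    qed
  qed
  have bound: "AE x in lborel. norm (f x - t n x) powr r \<le> norm (f x) powr r" for n
    by (auto simp: t_def)
  note conv = tendsto_integral_powr_dominated[OF _ _ f r lim bound]
  have int1: "integrable lborel (\<lambda>x. norm (f x - t n x) powr r)" for n
    by (rule conv(1)) measurable
  \<comment> \<open>Chosen so that the two errors add up to \<open>e\<close> after the factor \<open>2 powr r\<close> lost in \<open>powr_sum_le\<close>.\<close>
  define e' where "e' = e / (2 * 2 powr r)"
  have e': "e' > 0" using e by (simp add: e'_def)
  have "(\<lambda>n. \<integral>x. norm (f x - t n x) powr r \<partial>lborel) \<longlonglongrightarrow> (\<integral>(x::'a). norm (0::complex) powr r \<partial>lborel)"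
    by (rule conv(2)) measurable
  then have "\<forall>\<^sub>F n in sequentially. (\<integral>x. norm (f x - t n x) powr r \<partial>lborel) < e'"
    using e' by (intro order_tendstoD(2)[where y=0]) auto
  then obtain n where n: "(\<integral>x. norm (f x - t n x) powr r \<partial>lborel) < e'"
    by (auto simp: eventually_sequentially)
  obtain u where u: "compact_support u (real n + 1)" "integrable lborel (\<lambda>x. norm (t n x - u x) powr r)"
      "(\<integral>x. norm (t n x - u x) powr r \<partial>lborel) < e'"
    by (rule compact_support_dense_bounded[of "t n" "real n + 1" "real n" r e'])
       (use r e' in \<open>auto simp: t_def\<close>)
  have [measurable]: "u \<in> borel_measurable borel" by (rule borel_measurable_compact_support[OF u(1)])
  have le: "norm (f x - u x) powr r \<le> 2 powr r * (norm (f x - t n x) powr r + norm (t n x - u x) powr r)" for x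
  proof -
    have "norm (f x - u x) \<le> norm (f x - t n x) + norm (t n x - u x)"
      using norm_triangle_ineq[of "f x - t n x" "t n x - u x"] by simp
    then have "norm (f x - u x) powr r \<le> (norm (f x - t n x) + norm (t n x - u x)) powr r"
      using r by (intro powr_mono2) auto
    also have "\<dots> \<le> 2 powr r * (norm (f x - t n x) powr r + norm (t n x - u x) powr r)"
      using r by (intro powr_sum_le) auto
    finally show ?thesis .
  qed
  have int2: "integrable lborel (\<lambda>x. 2 powr r * (norm (f x - t n x) powr r + norm (t n x - u x) powr r))"
    using int1 u(2) by simp
  have int: "integrable lborel (\<lambda>x. norm (f x - u x) powr r)"
    by (rule Bochner_Integration.integrable_bound[OF int2]) (auto intro!: AE_I2 order_trans[OF le])
  have "(\<integral>x. norm (f x - u x) powr r \<partial>lborel) \<le> (\<integral>x. 2 powr r * (norm (f x - t n x) powr r + norm (t n x - u x) powr r) \<partial>lborel)"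
    by (rule integral_mono[OF int int2 le])
  also have "\<dots> = 2 powr r * ((\<integral>x. norm (f x - t n x) powr r \<partial>lborel) + (\<integral>x. norm (t n x - u x) powr r \<partial>lborel))"
    using int1 u(2) by simp
  also have "\<dots> < 2 powr r * (e' + e')" using n u(3) by (intro mult_strict_left_mono) auto
  also have "\<dots> = e" by (simp add: e'_def)
  finally show thesis using that[OF u(1) int] by blast
qed

lemma small_powr_mult:
  fixes K s e :: real
  assumes "K \<ge> 0" "s > 0" "e > 0"
  obtains d where "d > 0" "\<And>x. 0 \<le> x \<Longrightarrow> x < d \<Longrightarrow> x powr s * K \<le> e"
proof (rule that[of "(e / (K + 1)) powr (1 / s)"])
  fix x assume x: "0 \<le> x" "x < (e / (K + 1)) powr (1 / s)"
  have "x powr s \<le> ((e / (K + 1)) powr (1 / s)) powr s" using x assms by (intro powr_mono2) auto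
  also have "\<dots> = e / (K + 1)" using assms by (simp add: powr_powr)
  finally have "x powr s * K \<le> e / (K + 1) * (K + 1)" using assms by (intro mult_mono) auto
  then show "x powr s * K \<le> e" using assms by simp
qed (use assms in auto)

lemma C0_uniform_limit:
  fixes B :: "'a::euclidean_space \<Rightarrow> complex"
  assumes approx: "\<And>e. e > 0 \<Longrightarrow> \<exists>F\<in>C0_space. \<forall>X. norm (B X - F X) \<le> e"
  shows "B \<in> C0_space"
  unfolding C0_space_def mem_Collect_eq
proof
  have "\<exists>F. \<forall>n. F n \<in> C0_space \<and> (\<forall>X. norm (B X - F n X) \<le> inverse (real (Suc n)))"
    by (intro choice allI) (use approx in \<open>simp add: Bex_def\<close>)
  then obtain F where F: "\<And>n. F n \<in> C0_space" "\<And>n X. norm (B X - F n X) \<le> inverse (real (Suc n))"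
    by blast
  show "continuous_on UNIV B"
  proof (rule uniform_limit_theorem)
    show "\<forall>\<^sub>F n in sequentially. continuous_on UNIV (F n)" using F(1) by (auto simp: C0_space_def)
    show "uniform_limit UNIV F B sequentially"
    proof (rule uniform_limitI)
      fix e :: real assume "e > 0"
      then have "\<forall>\<^sub>F n in sequentially. inverse (real (Suc n)) < e"
        using LIMSEQ_inverse_real_of_nat by (rule order_tendstoD(2)[rotated])
      then show "\<forall>\<^sub>F n in sequentially. \<forall>X\<in>UNIV. dist (F n X) (B X) < e"
        by eventually_elim (auto simp: dist_norm norm_minus_commute intro: le_less_trans[OF F(2)])
    qed
  qed simp
  show "(B \<longlongrightarrow> 0) at_infinity"
  proof (rule tendstoI)
    fix e :: real assume e: "e > 0"
    obtain F where F: "F \<in> C0_space" "\<And>X. norm (B X - F X) \<le> e / 2" using approx[of "e / 2"] e by auto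
    have "\<forall>\<^sub>F X in at_infinity. dist (F X) 0 < e / 2"
      by (rule tendstoD) (use F(1) e in \<open>auto simp: C0_space_def\<close>)
    then show "\<forall>\<^sub>F X in at_infinity. dist (B X) 0 < e"
    proof eventually_elim
      fix X assume "dist (F X) 0 < e / 2"
      moreover have "norm (B X) \<le> norm (B X - F X) + norm (F X)"
        using norm_triangle_ineq[of "B X - F X" "F X"] by simp
      ultimately show "dist (B X) 0 < e" using F(2)[of X] by simp
    qed
  qed
qed

text \<open>The Riemann-Lebesgue argument: translating by \<open>h\<close> with \<open>\<omega> \<bullet> h = 1/2\<close> changes the sign of the
  character, so the transform is half that of \<open>S - S (h + \<cdot>)\<close>. For large \<open>\<omega>\<close> the shift \<open>h\<close> can be taken
  small.\<close>

lemma fourier_half_shift: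
  fixes S :: "'a::euclidean_space \<Rightarrow> complex"
  assumes S: "integrable lborel S" and \<omega>: "\<omega> \<bullet> h = 1 / 2"
  shows "norm (fourier S \<omega>) \<le> (\<integral>y. norm (S y - S (h + y)) \<partial>lborel) / 2"
proof -
  note [measurable] = borel_measurable_integrable[OF S, simplified]
  let ?e = "\<lambda>y. cis (- (2 * pi * (\<omega> \<bullet> y)))"
  have Sh: "integrable lborel (\<lambda>y. S (h + y))"
    using S by (subst (asm) lborel_distr_plus[of h, symmetric], subst (asm) integrable_distr_eq) auto
  have shift: "?e (h + y) = - ?e y" for y
  proof -
    have "?e (h + y) = cis (- pi) * ?e y"
      unfolding cis_mult by (simp add: inner_add_right \<omega> algebra_simps)
    also have "cis (- pi) = - 1" by (simp add: complex_eq_iff)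
    finally show ?thesis by simp
  qed
  have "fourier S \<omega> = (\<integral>y. ?e y * S y \<partial>distr lborel borel ((+) h))"
    by (simp add: fourier_def lborel_distr_plus)
  also have "\<dots> = (\<integral>y. ?e (h + y) * S (h + y) \<partial>lborel)"
    by (subst integral_distr) auto
  also have "\<dots> = - fourier (\<lambda>y. S (h + y)) \<omega>"
    by (simp add: shift fourier_def)
  finally have "2 * fourier S \<omega> = fourier S \<omega> - fourier (\<lambda>y. S (h + y)) \<omega>" by simp
  also have "\<dots> = (\<integral>y. ?e y * (S y - S (h + y)) \<partial>lborel)"
    unfolding fourier_def right_diff_distrib
    by (rule Bochner_Integration.integral_diff[symmetric]; rule integrable_fourier) (simp_all add: S Sh)
  finally have "2 * norm (fourier S \<omega>) = norm (\<integral>y. ?e y * (S y - S (h + y)) \<partial>lborel)"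
    by (metis norm_mult norm_numeral)
  also have "\<dots> \<le> (\<integral>y. norm (?e y * (S y - S (h + y))) \<partial>lborel)" by (rule integral_norm_bound)
  also have "\<dots> = (\<integral>y. norm (S y - S (h + y)) \<partial>lborel)" by (simp add: norm_mult)
  finally show ?thesis by simp
qed

context wigner_pair
begin

lemma matrix_bound:
  obtains k where "k > 0" "\<And>y. norm (P *v y) \<le> k * norm y" "\<And>y. norm (Q *v y) \<le> k * norm y"
proof -
  have bl: "bounded_linear ((*v) P)" "bounded_linear ((*v) Q)" by (simp_all add: linear_linear)
  obtain k where k: "k > 0" "\<And>y. norm (P *v y) \<le> norm y * k"
    using bounded_linear.pos_bounded[OF bl(1)] by blast
  obtain l where l: "l > 0" "\<And>y. norm (Q *v y) \<le> norm y * l"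
    using bounded_linear.pos_bounded[OF bl(2)] by blast
  show thesis
  proof (rule that[of "max k l"])
    fix y :: "real^'n"
    have "norm y * k \<le> max k l * norm y" "norm y * l \<le> max k l * norm y"
      by (subst mult.commute, rule mult_right_mono; simp)+
    then show "norm (P *v y) \<le> max k l * norm y" "norm (Q *v y) \<le> max k l * norm y"
      using k(2)[of y] l(2)[of y] by linarith+
  qed (use k in auto)
qed

lemma slice_support:
  assumes "compact_support f R" "compact_support g R" and "slice f g x y \<noteq> 0"
  shows "norm y \<le> 2 * R" "norm (x + P *v y) \<le> R"
proof -
  have *: "norm (x + P *v y) \<le> R" "norm (x + Q *v y) \<le> R"
    using assms by (auto simp: slice_def compact_support_def not_less[symmetric])
  have "y = (x + P *v y) - (x + Q *v y)" using P_minus_Q[of y] by simp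
  then have "norm y \<le> norm (x + P *v y) + norm (x + Q *v y)" using norm_triangle_ineq4 by metis
  then show "norm y \<le> 2 * R" "norm (x + P *v y) \<le> R" using * by auto
qed

text \<open>If a slice is not identically zero, then \<open>x + P y\<close> and \<open>x + Q y\<close> both lie in the support for some
  \<open>y\<close>, which confines \<open>y\<close>, their difference, and with it \<open>x\<close>. So the form vanishes for large \<open>x\<close>. For
  large \<open>\<omega>\<close> it is small by \<open>fourier_half_shift\<close>, because slices are uniformly continuous with a modulus
  that does not depend on \<open>x\<close>.\<close>

lemma wigner_compact_support_C0:
  assumes f: "compact_support f R" and g: "compact_support g R"
  shows "wigner f g \<in> C0_space"
proof -
  obtain Cf where Cf: "Cf \<ge> 0" "\<And>x. norm (f x) \<le> Cf" using compact_support_bounded[OF f] by blast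
  obtain Cg where Cg: "Cg \<ge> 0" "\<And>x. norm (g x) \<le> Cg" using compact_support_bounded[OF g] by blast
  obtain k where k: "k > 0" "\<And>y. norm (P *v y) \<le> k * norm y" "\<And>y. norm (Q *v y) \<le> k * norm y"
    using matrix_bound by blast
  have [measurable]: "f \<in> borel_measurable borel" "g \<in> borel_measurable borel"
    using borel_measurable_compact_support f g by auto
  have cont: "isCont f x" "isCont g x" for x
    using f g by (auto simp: compact_support_def continuous_on_eq_continuous_at)
  have contPQ: "isCont ((*v) P) y" "isCont ((*v) Q) y" for y
    by (auto intro!: linear_continuous_at simp: linear_linear)
  have bound: "norm (slice f g x y) \<le> Cf * Cg * indicator (cball 0 (2 * R)) y" for x y
  proof (cases "slice f g x y = 0")
    case False
    have "norm (slice f g x y) \<le> Cf * Cg"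
      unfolding slice_def norm_mult complex_mod_cnj using Cf Cg by (intro mult_mono) auto
    then show ?thesis using slice_support(1)[OF f g False] by simp
  qed (use Cf Cg in simp)
  have int_w: "integrable lborel (\<lambda>y::real^'n. Cf * Cg * indicator (cball 0 (2 * R)) y)"
    by (intro integrable_mult_right integrable_cball_indicator)
  have int: "integrable lborel (slice f g x)" for x
    by (rule Bochner_Integration.integrable_bound[OF int_w])
       (auto simp: slice_def[abs_def] intro!: AE_I2 order_trans[OF bound[unfolded slice_def]])
  have "continuous_on UNIV (wigner f g)"
    unfolding continuous_on_sequentially
  proof (intro ballI allI impI, elim conjE)
    fix X and S :: "nat \<Rightarrow> (real^'n) \<times> (real^'n)"
    assume S: "S \<longlonglongrightarrow> X"
    show "(wigner f g \<circ> S) \<longlonglongrightarrow> wigner f g X"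
      unfolding wigner_def fourier_def o_def
    proof (rule integral_dominated_convergence[OF _ _ int_w])
      have cis: "isCont cis t" for t
        using continuous_on_cis[OF continuous_on_id, of UNIV] by (simp add: continuous_on_eq_continuous_at)
      show "AE y in lborel. (\<lambda>n. cis (- (2 * pi * (snd (S n) \<bullet> y))) * slice f g (fst (S n)) y)
          \<longlonglongrightarrow> cis (- (2 * pi * (snd X \<bullet> y))) * slice f g (fst X) y"
        unfolding slice_def
        by (intro AE_I2 tendsto_intros S isCont_tendsto_compose[OF cont(1)] isCont_tendsto_compose[OF cont(2)]
            isCont_tendsto_compose[OF cis])
      show "AE y in lborel. norm (cis (- (2 * pi * (snd (S n) \<bullet> y))) * slice f g (fst (S n)) y)
          \<le> Cf * Cg * indicator (cball 0 (2 * R)) y" for n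
        using bound by (simp add: norm_mult)
    qed (unfold slice_def, measurable)
  qed
  moreover have "(wigner f g \<longlongrightarrow> 0) at_infinity"
  proof (rule tendstoI)
    fix e :: real assume e: "e > 0"
    define V where "V = measure lborel (cball (0::real^'n) (2 * R + 1))"
    define d where "d = e / ((Cf + Cg + 1) * (V + 1))"
    have V: "V \<ge> 0" by (simp add: V_def)
    have d: "d > 0" using e V Cf Cg by (simp add: d_def)
    obtain df where df: "df > 0" "\<And>x y. norm (x - y) < df \<Longrightarrow> norm (f x - f y) < d"
      using compact_support_uniformly_continuous[OF f d] by blast
    obtain dg where dg: "dg > 0" "\<And>x y. norm (x - y) < dg \<Longrightarrow> norm (g x - g y) < d"
      using compact_support_uniformly_continuous[OF g d] by blast
    define m where "m = min 1 (min (df / (2 * k)) (dg / (2 * k)))"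
    have m: "m > 0" "m \<le> 1" "k * m < df" "k * m < dg"
    proof -
      show "m > 0" "m \<le> 1" using df dg k by (auto simp: m_def)
      have "m \<le> df / (2 * k)" "m \<le> dg / (2 * k)" by (auto simp: m_def)
      then have "k * m \<le> df / 2" "k * m \<le> dg / 2" using k by (auto simp: field_simps)
      then show "k * m < df" "k * m < dg" using df dg by auto
    qed
    define \<Omega> where "\<Omega> = 1 / (2 * m)"
    have freq: "norm (wigner f g X) < e" if X: "norm (snd X) \<ge> \<Omega>" for X
    proof -
      have \<Omega>: "\<Omega> > 0" using m by (simp add: \<Omega>_def)
      \<comment> \<open>The shortest shift that changes the sign of the character; its length is \<open>1 / (2 \<bar>\<omega>\<bar>)\<close>.\<close>
      define h where "h = (1 / (2 * (norm (snd X))\<^sup>2)) *\<^sub>R snd X"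
      have n0: "norm (snd X) > 0" using X \<Omega> by linarith
      have inner_h: "snd X \<bullet> h = 1 / 2" using n0 by (simp add: h_def power2_norm_eq_inner)
      have "norm h = 1 / (2 * norm (snd X))" using n0 by (simp add: h_def power2_eq_square)
      also have "\<dots> \<le> 1 / (2 * \<Omega>)" using X \<Omega> by (simp add: frac_le)
      finally have h: "norm h \<le> m" using m by (simp add: \<Omega>_def)
      let ?S = "slice f g (fst X)"
      have le: "norm (?S y - ?S (h + y)) \<le> (Cf + Cg) * d * indicator (cball 0 (2 * R + 1)) y" for y
      proof (cases "norm y \<le> 2 * R + 1")
        case True
        let ?a = "fst X + P *v y" and ?a' = "fst X + P *v (h + y)" and ?b = "fst X + Q *v y" and ?b' = "fst X + Q *v (h + y)"
        have "norm (?a - ?a') \<le> k * norm h" "norm (?b - ?b') \<le> k * norm h"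
          using k(2)[of h] k(3)[of h] by (simp_all add: matrix_vector_right_distrib)
        moreover have "k * norm h \<le> k * m" using h k by simp
        ultimately have "norm (?a - ?a') < df" "norm (?b - ?b') < dg" using m by linarith+
        then have fd: "norm (f ?a - f ?a') \<le> d" and gd: "norm (g ?b - g ?b') \<le> d"
          using df dg less_imp_le by blast+
        have "?S y - ?S (h + y) = (f ?a - f ?a') * cnj (g ?b) + f ?a' * cnj (g ?b - g ?b')"
          by (simp add: slice_def algebra_simps)
        then have "norm (?S y - ?S (h + y)) \<le> norm (f ?a - f ?a') * norm (g ?b) + norm (f ?a') * norm (g ?b - g ?b')"
          using norm_triangle_ineq[of "(f ?a - f ?a') * cnj (g ?b)" "f ?a' * cnj (g ?b - g ?b')"]
          by (simp only: norm_mult complex_mod_cnj)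
        also have "\<dots> \<le> d * Cg + Cf * d"
          using fd gd Cf Cg d by (intro add_mono mult_mono) auto
        finally show ?thesis using True by (simp add: algebra_simps)
      next
        case False
        have "norm y \<le> norm (h + y) + norm h" using norm_triangle_ineq4[of "h + y" h] by simp
        then have "\<not> norm (h + y) \<le> 2 * R" "\<not> norm y \<le> 2 * R" using False h m by linarith+
        then have "?S y = 0" "?S (h + y) = 0" using slice_support(1)[OF f g] by blast+
        then show ?thesis using Cf Cg d by simp
      qed
      have "norm (wigner f g X) \<le> (\<integral>y. norm (?S y - ?S (h + y)) \<partial>lborel) / 2"
        unfolding wigner_def by (rule fourier_half_shift[OF int inner_h])
      also have "\<dots> \<le> (\<integral>y. (Cf + Cg) * d * indicator (cball (0::real^'n) (2 * R + 1)) y \<partial>lborel) / 2"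
        by (intro divide_right_mono integral_mono' le) (use integrable_cball_indicator Cf Cg d in auto)
      also have "\<dots> = (Cf + Cg) * d * V / 2" by (simp add: V_def)
      also have "\<dots> < (Cf + Cg + 1) * d * (V + 1)"
      proof -
        have "(Cf + Cg) * d * V \<le> (Cf + Cg + 1) * d * (V + 1)"
          using Cf Cg V d by (intro mult_mono) auto
        moreover have "0 < (Cf + Cg + 1) * d * (V + 1)" using Cf Cg V d by simp
        ultimately show ?thesis by linarith
      qed
      also have "\<dots> = e"
      proof -
        have "(Cf + Cg + 1) * (V + 1) > 0" using Cf Cg V by simp
        then have "(Cf + Cg + 1) * (V + 1) \<noteq> 0" by linarith
        from nonzero_mult_div_cancel_left[OF this, of e] have "(Cf + Cg + 1) * (V + 1) * d = e"
          by (simp only: d_def times_divide_eq_right)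
        then show ?thesis by (simp add: mult_ac)
      qed
      finally show ?thesis .
    qed
    have space: "wigner f g X = 0" if X: "norm (fst X) > R + k * (2 * R)" for X
    proof -
      have "slice f g (fst X) y = 0" for y
      proof (rule ccontr)
        assume "slice f g (fst X) y \<noteq> 0"
        note s = slice_support[OF f g this]
        have "norm (fst X) \<le> norm (fst X + P *v y) + norm (P *v y)"
          using norm_triangle_ineq4[of "fst X + P *v y" "P *v y"] by simp
        also have "\<dots> \<le> R + k * norm y" using s k(2)[of y] by linarith
        also have "\<dots> \<le> R + k * (2 * R)" using s k by simp
        finally show False using X by simp
      qed
      then show ?thesis by (simp add: wigner_def fourier_def)
    qed
    show "\<forall>\<^sub>F X in at_infinity. dist (wigner f g X) 0 < e"
      unfolding eventually_at_infinity
    proof (intro exI allI impI)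
      fix X :: "(real^'n) \<times> (real^'n)"
      assume X: "\<bar>R + k * (2 * R)\<bar> + \<bar>\<Omega>\<bar> + 1 \<le> norm X"
      have "norm X \<le> norm (fst X) + norm (snd X)" using norm_Pair_le[of "fst X" "snd X"] by simp
      then have "norm (fst X) > R + k * (2 * R) \<or> norm (snd X) \<ge> \<Omega>" using X by linarith
      then show "dist (wigner f g X) 0 < e" using freq[of X] space[of X] e by auto
    qed
  qed
  ultimately show ?thesis by (simp add: C0_space_def)
qed

lemma wigner_add_left:
  assumes "integrable lborel (slice f g (fst X))" "integrable lborel (slice f' g (fst X))"
  shows "wigner (\<lambda>x. f x + f' x) g X = wigner f g X + wigner f' g X"
proof -
  have "slice (\<lambda>x. f x + f' x) g (fst X) = (\<lambda>y. slice f g (fst X) y + slice f' g (fst X) y)"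
    by (auto simp: slice_def algebra_simps)
  then show ?thesis
    unfolding wigner_def fourier_def using integrable_fourier[OF assms(1)] integrable_fourier[OF assms(2)]
    by (simp add: distrib_left)
qed

lemma wigner_add_right:
  assumes "integrable lborel (slice f g (fst X))" "integrable lborel (slice f g' (fst X))"
  shows "wigner f (\<lambda>x. g x + g' x) X = wigner f g X + wigner f g' X"
proof -
  have "slice f (\<lambda>x. g x + g' x) (fst X) = (\<lambda>y. slice f g (fst X) y + slice f g' (fst X) y)"
    by (auto simp: slice_def algebra_simps)
  then show ?thesis
    unfolding wigner_def fourier_def using integrable_fourier[OF assms(1)] integrable_fourier[OF assms(2)]
    by (simp add: distrib_left)
qed

text \<open>With \<open>u\<close> close to \<open>f\<close> and then \<open>v\<close> close to \<open>g\<close>, the splitting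
  \<open>B(f, g) - B(u, v) = B(f - u, g) + B(u, g - v)\<close> and the boundedness estimate give a uniform
  approximation. Here \<open>v\<close> is chosen last, because its accuracy depends on the norm of \<open>u\<close>.\<close>

lemma wigner_C0:
  assumes [measurable]: "f \<in> borel_measurable borel" "g \<in> borel_measurable borel"
    and a: "0 < a" "a < 1"
    and f: "integrable lborel (\<lambda>x. norm (f x) powr (1 / a))"
    and g: "integrable lborel (\<lambda>x. norm (g x) powr (1 / (1 - a)))"
  shows "wigner f g \<in> C0_space"
proof (rule C0_uniform_limit)
  fix e :: real assume "e > 0"
  then have e2: "e / 2 > 0" by simp
  have a': "1 / a > 0" "1 / (1 - a) > 0" using a by auto
  let ?D = "\<bar>det P\<bar> powr a * \<bar>det Q\<bar> powr (1 - a)"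
  let ?F = "\<lambda>f. \<integral>x. norm (f x) powr (1 / a) \<partial>lborel"
  let ?G = "\<lambda>g. \<integral>x. norm (g x) powr (1 / (1 - a)) \<partial>lborel"
  obtain d where d: "d > 0" "\<And>x. 0 \<le> x \<Longrightarrow> x < d \<Longrightarrow> x powr a * (?G g powr (1 - a) / ?D) \<le> e / 2"
    using small_powr_mult[OF _ a(1) e2, of "?G g powr (1 - a) / ?D"] by auto
  obtain u R where u: "compact_support u R" "integrable lborel (\<lambda>x. norm (f x - u x) powr (1 / a))" "?F (\<lambda>x. f x - u x) < d"
    using compact_support_dense[OF _ f a'(1) d(1)] by auto
  obtain d' where d': "d' > 0" "\<And>x. 0 \<le> x \<Longrightarrow> x < d' \<Longrightarrow> x powr (1 - a) * (?F u powr a / ?D) \<le> e / 2"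
    using small_powr_mult[OF _ _ e2, of "?F u powr a / ?D" "1 - a"] a by auto
  obtain v R' where v: "compact_support v R'" "integrable lborel (\<lambda>x. norm (g x - v x) powr (1 / (1 - a)))" "?G (\<lambda>x. g x - v x) < d'"
    using compact_support_dense[OF _ g a'(2) d'(1)] by auto
  have [measurable]: "u \<in> borel_measurable borel" "v \<in> borel_measurable borel"
    using u(1) v(1) by (auto intro: borel_measurable_compact_support)
  note iu = integrable_compact_support[OF u(1) a'(1)] and iv = integrable_compact_support[OF v(1) a'(2)]
  have fu: "(\<lambda>x. f x - u x) \<in> borel_measurable borel" and gv: "(\<lambda>x. g x - v x) \<in> borel_measurable borel"
    by measurable
  show "\<exists>F\<in>C0_space. \<forall>X. norm (wigner f g X - F X) \<le> e"
  proof (intro bexI allI)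
    have "compact_support u (max R R')" "compact_support v (max R R')"
      using u(1) v(1) by (auto simp: compact_support_def)
    then show "wigner u v \<in> C0_space" by (rule wigner_compact_support_C0)
    fix X
    have "wigner f g X = wigner (\<lambda>x. (f x - u x) + u x) g X" by simp
    also have "\<dots> = wigner (\<lambda>x. f x - u x) g X + wigner u g X"
      by (rule wigner_add_left; rule wigner_bounded(1)[OF _ _ a _ g]) (simp_all add: u iu)
    also have "wigner u g X = wigner u (\<lambda>x. (g x - v x) + v x) X" by simp
    also have "\<dots> = wigner u (\<lambda>x. g x - v x) X + wigner u v X"
      by (rule wigner_add_right; rule wigner_bounded(1)[OF _ _ a iu]) (simp_all add: v iv)
    finally have "wigner f g X - wigner u v X = wigner (\<lambda>x. f x - u x) g X + wigner u (\<lambda>x. g x - v x) X"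
      by simp
    moreover have "norm (wigner (\<lambda>x. f x - u x) g X) \<le> e / 2"
    proof -
      have "norm (wigner (\<lambda>x. f x - u x) g X) \<le> ?F (\<lambda>x. f x - u x) powr a * (?G g powr (1 - a) / ?D)"
        using wigner_bounded(2)[OF fu _ a u(2) g, of X] by simp
      also have "\<dots> \<le> e / 2" by (rule d(2)[OF _ u(3)]) simp
      finally show ?thesis .
    qed
    moreover have "norm (wigner u (\<lambda>x. g x - v x) X) \<le> e / 2"
    proof -
      have "norm (wigner u (\<lambda>x. g x - v x) X) \<le> ?G (\<lambda>x. g x - v x) powr (1 - a) * (?F u powr a / ?D)"
        using wigner_bounded(2)[OF _ gv a iu v(2), of X] by (simp add: mult.commute)
      also have "\<dots> \<le> e / 2" by (rule d'(2)[OF _ v(3)]) simp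
      finally show ?thesis .
    qed
    ultimately show "norm (wigner f g X - wigner u v X) \<le> e"
      using norm_triangle_ineq[of "wigner (\<lambda>x. f x - u x) g X" "wigner u (\<lambda>x. g x - v x) X"] by simp
  qed
qed

end

section \<open>Lebesgue measurable functions\<close>

text \<open>Completeness of Lebesgue measure. It makes the integrand of the distribution measurable: \<open>f\<close> composed
  with an affine map agrees almost everywhere with a Borel function, although a Lebesgue measurable
  function composed with a merely Borel map need not be measurable.\<close>

lemma lebesgue_AE_eq_measurable:
  fixes f f' :: "'a::euclidean_space \<Rightarrow> complex"
  assumes f': "f' \<in> borel_measurable borel" and ae: "AE x in lborel. f x = f' x"
  shows "f \<in> borel_measurable lebesgue"
proof -
  have "AE x in lebesgue. f x = f' x" using ae by (rule AE_completion)
  then have ae': "AE x in lebesgue. x \<in> f' -` A \<longleftrightarrow> x \<in> f -` A" for A :: "complex set"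
    by eventually_elim simp
  have "f' \<in> borel_measurable lebesgue" using f' by (simp add: measurable_completion)
  then have pre: "f' -` A \<in> sets lebesgue" if "A \<in> sets borel" for A
    using measurable_sets[of f' lebesgue borel A] that by simp
  show ?thesis
  proof (rule measurableI)
    fix A :: "complex set" assume "A \<in> sets borel"
    \<comment> \<open>The preimages of a Borel set under \<open>f'\<close> and \<open>f\<close> differ by a null set.\<close>
    from completion.in_sets_AE[OF ae' pre[OF this]]
    show "f -` A \<inter> space lebesgue \<in> sets lebesgue" by simp
  qed simp
qed

lemma lebesgue_borel_representative:
  fixes f :: "'a::euclidean_space \<Rightarrow> complex"
  assumes f: "f \<in> borel_measurable lebesgue"
  obtains f' where "f' \<in> borel_measurable borel" "AE x in lborel. f x = f' x"
proof -
  have "(\<lambda>x. Re (f x)) \<in> borel_measurable lebesgue" "(\<lambda>x. Im (f x)) \<in> borel_measurable lebesgue"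
    using f by measurable
  from this[THEN completion_ex_borel_measurable_real]
  obtain u v where u: "u \<in> borel_measurable lborel" "AE x in lborel. Re (f x) = u x"
     and v: "v \<in> borel_measurable lborel" "AE x in lborel. Im (f x) = v x"
    by blast
  show thesis
  proof (rule that)
    show "(\<lambda>x. complex_of_real (u x) + \<i> * complex_of_real (v x)) \<in> borel_measurable borel"
      using u(1) v(1) by simp
    show "AE x in lborel. f x = complex_of_real (u x) + \<i> * complex_of_real (v x)"
      using u(2) v(2) by eventually_elim (simp add: complex_eq_iff)
  qed
qed

lemma Lp_space_borel_representative:
  fixes f :: "'a::euclidean_space \<Rightarrow> complex"
  assumes f: "f \<in> Lp_space (ereal r) lebesgue"
  obtains f' where "f' \<in> borel_measurable borel" "AE x in lborel. f x = f' x"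
    "integrable lborel (\<lambda>x. norm (f' x) powr r)"
    "Lp_norm (ereal r) lebesgue f = (\<integral>x. norm (f' x) powr r \<partial>lborel) powr (1 / r)"
proof -
  have f_meas: "f \<in> borel_measurable lebesgue" and int: "integrable lebesgue (\<lambda>x. norm (f x) powr r)"
    using f by (auto simp: Lp_space_def)
  obtain f' where f': "f' \<in> borel_measurable borel" "AE x in lborel. f x = f' x"
    using lebesgue_borel_representative[OF f_meas] by blast
  have meas': "(\<lambda>x. norm (f' x) powr r) \<in> borel_measurable lborel" using f'(1) by simp
  then have meas_leb: "(\<lambda>x. norm (f' x) powr r) \<in> borel_measurable lebesgue"
    by (rule measurable_completion)
  have ae: "AE x in lebesgue. norm (f x) powr r = norm (f' x) powr r"
    using AE_completion[OF f'(2)] by eventually_elim simp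
  have "integrable lebesgue (\<lambda>x. norm (f' x) powr r)"
    using int integrable_cong_AE[OF borel_measurable_integrable[OF int] meas_leb ae] by simp
  then have "integrable lborel (\<lambda>x. norm (f' x) powr r)"
    using integrable_completion[OF meas'] by simp
  moreover have "(\<integral>x. norm (f x) powr r \<partial>lebesgue) = (\<integral>x. norm (f' x) powr r \<partial>lborel)"
    using integral_cong_AE[OF borel_measurable_integrable[OF int] meas_leb ae] integral_completion[OF meas'] by simp
  ultimately show thesis using that[OF f'] by (simp add: Lp_norm_def)
qed

lemma blocks_block_matrix:
  "block11 (block_matrix A B C D) = A" "block12 (block_matrix A B C D) = B"
  "block21 (block_matrix A B C D) = C" "block22 (block_matrix A B C D) = D"
  by (simp_all add: block11_def block12_def block21_def block22_def block_matrix_def vec_eq_iff)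

lemma conjugate_exponent:
  assumes a: "0 < a" "a < 1" and eq: "ereal a + 1 / s = 1"
  shows "s = ereal (1 / (1 - a))"
proof (cases s)
  case (real t)
  have t0: "t \<noteq> 0"
  proof
    assume "t = 0"
    then have inf: "1 / s = \<infinity>" using real by (simp add: divide_ereal_def zero_ereal_def[symmetric])
    from eq[unfolded inf] show False by simp
  qed
  then have "1 / s = ereal (1 / t)" using real by (simp add: one_ereal_def)
  then have "a + 1 / t = 1" using eq by (simp add: one_ereal_def)
  then show ?thesis using real t0 a by (simp add: field_simps)
next
  case PInf
  then show ?thesis using eq a by (simp add: one_ereal_def)
next
  case MInf
  then show ?thesis using eq a by (simp add: one_ereal_def)
qed

theorem theorem4p14:
  fixes M :: "real ^ 'n ^ 'n"
    and p p' q q' :: ereal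
    and f g :: "real ^ 'n \<Rightarrow> complex"
  assumes "invertible (M + (1/2) *\<^sub>R mat 1)"
    and "invertible (M - (1/2) *\<^sub>R mat 1)"
    and "1 < p" and "p < \<infinity>"
    and "2 \<le> q" and "q \<le> \<infinity>"
    and "1 / p + 1 / p' = 1"
    and "1 / q + 1 / q' = 1"
    and "q' \<le> p" and "p \<le> q"
    and "f \<in> Lp_space p lebesgue"
    and "g \<in> Lp_space p' lebesgue"
  shows "(\<forall>x \<omega>. integrable lebesgue (B_integrand (A_mat M) f g x \<omega>))
    \<and> (B_dist (A_mat M) f g \<in> Lp_space q lebesgue
       \<and> Lp_norm q lebesgue (B_dist (A_mat M) f g)
           \<le> Lp_norm p lebesgue f * Lp_norm p' lebesgue g
             / (\<bar>det (M + (1/2) *\<^sub>R mat 1)\<bar> powr real_of_ereal (1 / p - 1 / q)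
                * \<bar>det (M - (1/2) *\<^sub>R mat 1)\<bar> powr real_of_ereal (1 / p' - 1 / q))
       \<and> bounded (range (B_dist (A_mat M) f g)))
    \<and> B_dist (A_mat M) f g \<in> C0_space"
proof -
  define P where "P = M + (1/2) *\<^sub>R mat 1"
  define Q where "Q = M - (1/2) *\<^sub>R mat 1"
  interpret wigner_pair P Q
  proof
    show "invertible P" "invertible Q" using assms(1,2) by (simp_all add: P_def Q_def)
    have "M + (1/2) *\<^sub>R mat 1 = M - (1/2) *\<^sub>R mat 1 + (1/2 + 1/2) *\<^sub>R (mat 1 :: real ^ 'n ^ 'n)"
      unfolding scaleR_add_left by simp
    then show "P = Q + mat 1" by (simp add: P_def Q_def)
  qed
  obtain r where p: "p = ereal r" using assms(3,4) by (cases p) auto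
  define a where "a = 1 / r"
  have r: "r > 1" using assms(3) by (simp add: p one_ereal_def)
  have a: "0 < a" "a < 1" "r = 1 / a" using r by (auto simp: a_def)
  have inv_p: "1 / p = ereal a" using r by (simp add: p a_def one_ereal_def)
  have p': "p' = ereal (1 / (1 - a))"
    using assms(7) unfolding inv_p by (rule conjugate_exponent[OF a(1,2)])
  have inv_p': "1 / p' = ereal (1 - a)" using a by (simp add: p' one_ereal_def)
  obtain f' where f'[measurable]: "f' \<in> borel_measurable borel" and f_ae: "AE x in lborel. f x = f' x"
    and int_f: "integrable lborel (\<lambda>x. norm (f' x) powr (1 / a))"
    and norm_f: "Lp_norm p lebesgue f = (\<integral>x. norm (f' x) powr (1 / a) \<partial>lborel) powr a"
    using Lp_space_borel_representative[of f r] assms(11) a unfolding p a(3) by auto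
  obtain g' where g'[measurable]: "g' \<in> borel_measurable borel" and g_ae: "AE x in lborel. g x = g' x"
    and int_g: "integrable lborel (\<lambda>x. norm (g' x) powr (1 / (1 - a)))"
    and norm_g: "Lp_norm p' lebesgue g = (\<integral>x. norm (g' x) powr (1 / (1 - a)) \<partial>lborel) powr (1 - a)"
    using Lp_space_borel_representative[of g "1 / (1 - a)"] assms(12) a unfolding p' by auto
  let ?S = "\<lambda>x \<omega> y. cis (- (2 * pi * (\<omega> \<bullet> y))) * slice f' g' x y"
  have integrand: "B_integrand (A_mat M) f g x \<omega> y
      = cis (- (2 * pi * (\<omega> \<bullet> y))) * (f (x + P *v y) * cnj (g (x + Q *v y)))" for x \<omega> y
    by (simp add: B_integrand_def A_mat_def blocks_block_matrix cis_conv_exp P_def Q_def mult_ac)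
  have ae: "AE y in lborel. B_integrand (A_mat M) f g x \<omega> y = ?S x \<omega> y" for x \<omega>
    using AE_affine[OF invertible_P f_ae, of x] AE_affine[OF invertible_Q g_ae, of x]
    by eventually_elim (simp add: integrand slice_def)
  have S_meas: "?S x \<omega> \<in> borel_measurable borel" for x \<omega>
    unfolding slice_def by measurable
  have S_int: "integrable lborel (?S x \<omega>)" for x \<omega>
    by (rule integrable_fourier[OF wigner_bounded(1)[OF f' g' a(1,2) int_f int_g]])
  have B_meas: "B_integrand (A_mat M) f g x \<omega> \<in> borel_measurable lebesgue" for x \<omega>
    by (rule lebesgue_AE_eq_measurable[OF S_meas ae])
  have S_meas': "?S x \<omega> \<in> borel_measurable lborel" "?S x \<omega> \<in> borel_measurable lebesgue" for x \<omega>
    using S_meas[of \<omega> x] by (simp_all add: measurable_completion)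
  have S_int': "integrable lebesgue (?S x \<omega>)" for x \<omega>
    using integrable_completion[OF S_meas'(1)] S_int by simp
  have B_int: "integrable lebesgue (B_integrand (A_mat M) f g x \<omega>)" for x \<omega>
    using S_int'[of \<omega> x] integrable_cong_AE[OF B_meas S_meas'(2) AE_completion[OF ae]] by simp
  have B_eq: "B_dist (A_mat M) f g = wigner f' g'"
  proof
    fix X :: "(real^'n) \<times> (real^'n)"
    obtain x \<omega> where X: "X = (x, \<omega>)" by (cases X)
    have "B_dist (A_mat M) f g X = (\<integral>y. ?S x \<omega> y \<partial>lebesgue)"
      unfolding B_dist_def X using integral_cong_AE[OF B_meas S_meas'(2) AE_completion[OF ae]] by simp
    also have "\<dots> = (\<integral>y. ?S x \<omega> y \<partial>lborel)" by (rule integral_completion[OF S_meas'(1)])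
    also have "\<dots> = wigner f' g' X" by (simp add: wigner_def fourier_def X)
    finally show "B_dist (A_mat M) f g X = wigner f' g' X" .
  qed
  let ?W = "wigner f' g'"
  let ?F = "\<integral>x. norm (f' x) powr (1 / a) \<partial>lborel" and ?G = "\<integral>x. norm (g' x) powr (1 / (1 - a)) \<partial>lborel"
  have sup: "norm (?W X) \<le> ?F powr a * ?G powr (1 - a) / (\<bar>det P\<bar> powr a * \<bar>det Q\<bar> powr (1 - a))" for X
    by (rule wigner_bounded(2)[OF f' g' a(1,2) int_f int_g])
  have W_meas: "?W \<in> borel_measurable lborel" by simp
  have W_meas': "?W \<in> borel_measurable lebesgue" by (rule measurable_completion[OF W_meas])
  have Lq: "?W \<in> Lp_space q lebesgue \<and> Lp_norm q lebesgue ?W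
      \<le> ?F powr a * ?G powr (1 - a) / (\<bar>det P\<bar> powr real_of_ereal (ereal a - 1 / q) * \<bar>det Q\<bar> powr real_of_ereal (ereal (1 - a) - 1 / q))"
  proof (cases "q = \<infinity>")
    case True
    let ?C = "?F powr a * ?G powr (1 - a) / (\<bar>det P\<bar> powr a * \<bar>det Q\<bar> powr (1 - a))"
    have "esssup lebesgue (\<lambda>X. ereal (norm (?W X))) \<le> ereal ?C"
      using W_meas' by (intro esssup_I) (simp_all add: sup)
    moreover from this have "real_of_ereal (esssup lebesgue (\<lambda>X. ereal (norm (?W X)))) \<le> ?C"
      by (cases "esssup lebesgue (\<lambda>X. ereal (norm (?W X)))") auto
    ultimately show ?thesis
      using W_meas' True by (auto simp: Lp_space_def Lp_norm_def intro: le_less_trans)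
  next
    case False
    then obtain t where q: "q = ereal t" using assms(5) by (cases q) auto
    define b where "b = 1 / t"
    have t: "t \<ge> 2" "r \<le> t" using assms(5,10) by (simp_all add: q p)
    have inv_q: "1 / q = ereal b" using t by (simp add: q b_def one_ereal_def)
    have b: "0 < b" "b \<le> 1 / 2" "b \<le> a" "t = 1 / b"
      using t r by (auto simp: b_def a_def field_simps)
    have "q' = ereal (1 / (1 - b))"
      using assms(8) b unfolding inv_q by (intro conjugate_exponent) auto
    then have "1 / (1 - b) \<le> 1 / a" using assms(9) by (simp add: p a(3))
    then have ab: "a \<le> 1 - b" using a b by (simp add: field_simps)
    let ?D = "?F powr a * ?G powr (1 - a) / (\<bar>det P\<bar> powr (a - b) * \<bar>det Q\<bar> powr (1 - a - b))"
    have nn: "(\<integral>\<^sup>+X. ennreal (norm (?W X) powr (1 / b)) \<partial>lborel) \<le> ennreal (?D powr (1 / b))"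
      by (rule wigner_Lq[OF f' g' a(1,2) b(1,2,3) ab int_f int_g])
    have int_W: "integrable lborel (\<lambda>X. norm (?W X) powr (1 / b))"
      using nn by (intro integrableI_bounded) (auto intro: le_less_trans)
    have meas: "(\<lambda>X. norm (?W X) powr (1 / b)) \<in> borel_measurable lborel" by simp
    have int_W': "integrable lebesgue (\<lambda>X. norm (?W X) powr (1 / b))"
      using int_W integrable_completion[OF meas] by simp
    have "(\<integral>X. norm (?W X) powr (1 / b) \<partial>lborel) \<le> ?D powr (1 / b)"
      using nn by (simp add: nn_integral_eq_integral[OF int_W])
    then have "(\<integral>X. norm (?W X) powr (1 / b) \<partial>lborel) powr b \<le> (?D powr (1 / b)) powr b"
      using b by (intro powr_mono2) auto
    also have "\<dots> = ?D" using b by (simp add: powr_powr)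
    finally have "Lp_norm q lebesgue ?W \<le> ?D"
      using b by (simp add: Lp_norm_def q integral_completion[OF meas])
    moreover have "?W \<in> Lp_space q lebesgue"
      using W_meas' int_W' by (simp add: Lp_space_def q b(4))
    ultimately show ?thesis unfolding inv_q by simp
  qed
  have bdd: "bounded (range ?W)" using sup by (auto simp: bounded_iff)
  have C0: "?W \<in> C0_space" by (rule wigner_C0[OF f' g' a(1,2) int_f int_g])
  show ?thesis
    unfolding B_eq norm_f norm_g inv_p inv_p' P_def[symmetric] Q_def[symmetric]
    using B_int Lq bdd C0 by blast
qed

end
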